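(* Let $n\ge 1$, $I=[0,1]$, and let $(\mu_{\mathbf k})_{\mathbf k\in\mathbb N_0^n}$ be a multi-index sequence of real numbers. The following are equivalent: (i) $(\mu_{\mathbf k})$ solves the weak multilinear Hausdorff problem of moments, i.e. there exists a polymeasure $\gamma$ (of finite semivariation) on $\mathrm{Bo}(I)\times\cdots\times\mathrm{Bo}(I)$ ($n$ factors) such that $$\mu_{\mathbf k}=\int_{I^n} t_1^{k_1}\otimes\cdots\otimes t_n^{k_n}\,\gamma(dt_1,\ldots,dt_n)\qquad\text{for all }\mathbf k=(k_1,\ldots,k_n)\in\mathbb N_0^n .$$ (ii) $(\mu_{\mathbf k})$ is weakly bounded, i.e. there is a constant $C>0$ such that for every $\mathbf k=(k_1,\dots,k_n)\in\mathbb N_0^n$ and every choice of numbers $a^{(l)}_{m}$ ($l=1,\dots,n$, $0\le m\le k_l$) with $|a^{(l)}_{m}|\le 1$, $$\left|\sum_{m_1=0}^{k_1}\cdots\sum_{m_n=0}^{k_n} a^{(1)}_{m_1}\cdots a^{(n)}_{m_n}\,\lambda_{(\mathbf k;\mathbf m)}\right|\le C ,\qquad \mathbf m=(m_1,\ldots,m_n),$$ where $\lambda_{(\mathbf k;\mathbf m)}$ are the Bernstein coefficients of $(\mu_{\mathbf k})$.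
   Context: $\mathbb N_0=\{0,1,2,\dots\}$; $\mathrm{Bo}(I)$ is the Borel $\sigma$-algebra of $I=[0,1]$. Bernstein coefficients: let $L_\mu$ be the $n$-linear functional on $\mathbb R[t]\times\cdots\times\mathbb R[t]$ determined by $L_\mu(t^{k_1},\dots,t^{k_n})=\mu_{(k_1,\dots,k_n)}$. For $\mathbf m\le\mathbf k$ (componentwise), $$\lambda_{(\mathbf k;\mathbf m)}=L_\mu\Big(\tbinom{k_1}{m_1}t^{m_1}(1-t)^{k_1-m_1},\ldots,\tbinom{k_n}{m_n}t^{m_n}(1-t)^{k_n-m_n}\Big).$$ Polymeasure: a scalar (real or complex) function $\gamma$ on a product $\Sigma_1\times\cdots\times\Sigma_n$ of $\sigma$-algebras, $(A_1,\dots,A_n)\mapsto\gamma(A_1,\dots,A_n)$, which is separately $\sigma$-additive, i.e. $\sigma$-additive in each argument when the other arguments are fixed. Semivariation: $\|\gamma\|(A_1,\dots,A_n)=\sup\big|\sum_{k_1=1}^{r_1}\cdots\sum_{k_n=1}^{r_n}a_1^{k_1}\cdots a_n^{k_n}\gamma(A_1^{k_1},\dots,A_n^{k_n})\big|$, the supremum being over all finite measurable partitions $\{A_l^{k_l}\}_{k_l=1}^{r_l}$ of $A_l$ and all numbers with $|a_l^{k_l}|\le1$. Finite semivariation means that $\|\gamma\|$ of the whole space is finite. Integral: for $\gamma$ of finite semivariation and bounded measurable scalar functions $f_1,\dots,f_n$, the integral $\int f_1\otimes\cdots\otimes f_n\,\gamma$ is the $n$-linear expression in $(f_1,\dots,f_n)$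 that equals $\gamma(A_1,\dots,A_n)$ when $f_l=\chi_{A_l}$, extended by multilinearity to simple functions, and then to bounded measurable functions by taking limits along $n$-tuples of simple functions converging uniformly to $(f_1,\dots,f_n)$. Here $t_1^{k_1}\otimes\cdots\otimes t_n^{k_n}$ means $f_l(t)=t^{k_l}$. *)

theory Defs
  imports "HOL-Analysis.Analysis" "HOL-Computational_Algebra.Polynomial"
begin

text \<open>
  Multi-indices and \<open>n\<close>-tuples are functions on a finite (hence nonempty) index type \<open>'n\<close>, with
  \<open>n = CARD('n)\<close>. The scalar field \<open>'a\<close> is to be instantiated by \<^typ>\<open>real\<close> or \<^typ>\<open>complex\<close>.
  Only the space and the \<open>\<sigma>\<close>-algebra of the measures \<open>M l\<close> are used below.
\<close>

abbreviation Bo_I :: "real measure" where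
  "Bo_I \<equiv> restrict_space borel {0..1}"


subsection \<open>Polymeasures\<close>

text \<open>The values of \<open>\<gamma>\<close> outside the product of the \<open>\<sigma>\<close>-algebras are irrelevant.\<close>

definition polymeasure ::
  "('n::finite \<Rightarrow> 's measure) \<Rightarrow> (('n \<Rightarrow> 's set) \<Rightarrow> 'a::real_normed_field) \<Rightarrow> bool" where
  "polymeasure M \<gamma> \<longleftrightarrow>
     (\<forall>A l B. (\<forall>i. A i \<in> sets (M i)) \<longrightarrow> range B \<subseteq> sets (M l) \<longrightarrow> disjoint_family B \<longrightarrow>
        (\<lambda>j::nat. \<gamma> (A(l := B j))) sums \<gamma> (A(l := (\<Union>j. B j))))"

definition measurable_partition :: "'s measure \<Rightarrow> 's set \<Rightarrow> nat \<Rightarrow> (nat \<Rightarrow> 's set) \<Rightarrow> bool" where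
  "measurable_partition M A r E \<longleftrightarrow>
     (\<forall>j<r. E j \<in> sets M) \<and> disjoint_family_on E {..<r} \<and> (\<Union>j<r. E j) = A"

definition semivariation ::
  "('n::finite \<Rightarrow> 's measure) \<Rightarrow> (('n \<Rightarrow> 's set) \<Rightarrow> 'a::real_normed_field) \<Rightarrow> ('n \<Rightarrow> 's set) \<Rightarrow> ennreal"
where
  "semivariation M \<gamma> A =
     Sup {ennreal (norm (\<Sum>k \<in> PiE UNIV (\<lambda>l. {..<r l}). (\<Prod>l\<in>UNIV. a l (k l)) * \<gamma> (\<lambda>l. E l (k l))))
          | r E a. (\<forall>l. measurable_partition (M l) (A l) (r l) (E l)) \<and>
                   (\<forall>l. \<forall>j<r l. norm (a l j) \<le> 1)}"

definition finite_semivariation ::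
  "('n::finite \<Rightarrow> 's measure) \<Rightarrow> (('n \<Rightarrow> 's set) \<Rightarrow> 'a::real_normed_field) \<Rightarrow> bool" where
  "finite_semivariation M \<gamma> \<longleftrightarrow> semivariation M \<gamma> (\<lambda>l. space (M l)) < \<infinity>"


subsection \<open>Integration of tuples of bounded measurable functions\<close>

text \<open>For simple functions, the multilinear extension of \<open>(\<chi>\<^bsub>A l\<^esub>)\<^sub>l \<mapsto> \<gamma> A\<close> is evaluated on
  the canonical representations \<open>f l = (\<Sum>y. y \<chi>\<^bsub>{f l = y}\<^esub>)\<close>.\<close>

definition simple_polyintegral ::
  "('n::finite \<Rightarrow> 's measure) \<Rightarrow> (('n \<Rightarrow> 's set) \<Rightarrow> 'a::real_normed_field) \<Rightarrow> ('n \<Rightarrow> 's \<Rightarrow> 'a) \<Rightarrow> 'a"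
where
  "simple_polyintegral M \<gamma> f =
     (\<Sum>y \<in> PiE UNIV (\<lambda>l. f l ` space (M l)).
        (\<Prod>l\<in>UNIV. y l) * \<gamma> (\<lambda>l. f l -` {y l} \<inter> space (M l)))"

definition uniform_simple_approx ::
  "('n::finite \<Rightarrow> 's measure) \<Rightarrow> (nat \<Rightarrow> 'n \<Rightarrow> 's \<Rightarrow> 'a::real_normed_field) \<Rightarrow> ('n \<Rightarrow> 's \<Rightarrow> 'a) \<Rightarrow> bool"
where
  "uniform_simple_approx M s f \<longleftrightarrow>
     (\<forall>j l. simple_function (M l) (s j l)) \<and>
     (\<forall>l. uniform_limit (space (M l)) (\<lambda>j. s j l) (f l) sequentially)"

text \<open>The integral as a relation: approximating sequences exist, and along each of them the
  integrals of the simple functions tend to \<open>x\<close>.\<close>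

definition has_polyintegral ::
  "('n::finite \<Rightarrow> 's measure) \<Rightarrow> (('n \<Rightarrow> 's set) \<Rightarrow> 'a::real_normed_field) \<Rightarrow> ('n \<Rightarrow> 's \<Rightarrow> 'a) \<Rightarrow> 'a \<Rightarrow> bool"
where
  "has_polyintegral M \<gamma> f x \<longleftrightarrow>
     (\<exists>s. uniform_simple_approx M s f) \<and>
     (\<forall>s. uniform_simple_approx M s f \<longrightarrow> (\<lambda>j. simple_polyintegral M \<gamma> (s j)) \<longlonglongrightarrow> x)"


subsection \<open>The moment problem and Bernstein coefficients\<close>

definition weak_hausdorff_solution ::
  "(('n::finite \<Rightarrow> nat) \<Rightarrow> real) \<Rightarrow> (('n \<Rightarrow> real set) \<Rightarrow> 'a::real_normed_field) \<Rightarrow> bool" where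
  "weak_hausdorff_solution \<mu> \<gamma> \<longleftrightarrow>
     polymeasure (\<lambda>_. Bo_I) \<gamma> \<and> finite_semivariation (\<lambda>_. Bo_I) \<gamma> \<and>
     (\<forall>k. has_polyintegral (\<lambda>_. Bo_I) \<gamma> (\<lambda>l t. of_real (t ^ k l)) (of_real (\<mu> k)))"

text \<open>The functional \<open>L\<^sub>\<mu>\<close>; the lemmas after it confirm its defining properties.\<close>

definition moment_functional ::
  "(('n::finite \<Rightarrow> nat) \<Rightarrow> real) \<Rightarrow> ('n \<Rightarrow> real poly) \<Rightarrow> real" where
  "moment_functional \<mu> p =
     (\<Sum>k \<in> PiE UNIV (\<lambda>l. {..degree (p l)}). (\<Prod>l\<in>UNIV. coeff (p l) (k l)) * \<mu> k)"

lemma moment_functional_bound: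
  assumes "\<And>l. degree (p l) \<le> d l"
  shows "moment_functional \<mu> p =
    (\<Sum>k \<in> PiE UNIV (\<lambda>l. {..d l}). (\<Prod>l\<in>UNIV. coeff (p l) (k l)) * \<mu> k)"
  unfolding moment_functional_def
proof (rule sum.mono_neutral_left)
  show "finite (PiE UNIV (\<lambda>l. {..d l}))"
    by (intro finite_PiE) auto
  show "PiE UNIV (\<lambda>l. {..degree (p l)}) \<subseteq> PiE UNIV (\<lambda>l. {..d l})"
    using assms by (intro PiE_mono) auto
  show "\<forall>k \<in> PiE UNIV (\<lambda>l. {..d l}) - PiE UNIV (\<lambda>l. {..degree (p l)}).
          (\<Prod>l\<in>UNIV. coeff (p l) (k l)) * \<mu> k = 0"
  proof
    fix k assume "k \<in> PiE UNIV (\<lambda>l. {..d l}) - PiE UNIV (\<lambda>l. {..degree (p l)})"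
    then obtain l where "degree (p l) < k l"
      by (auto simp: PiE_iff not_le)
    then have "coeff (p l) (k l) = 0"
      by (rule coeff_eq_0)
    then have "(\<Prod>l\<in>UNIV. coeff (p l) (k l)) = 0"
      by (intro prod_zero) auto
    then show "(\<Prod>l\<in>UNIV. coeff (p l) (k l)) * \<mu> k = 0"
      by simp
  qed
qed

lemma moment_functional_monom: "moment_functional \<mu> (\<lambda>l. monom 1 (k l)) = \<mu> k"
proof -
  have "moment_functional \<mu> (\<lambda>l. monom 1 (k l)) =
    (\<Sum>j \<in> PiE UNIV (\<lambda>l. {..k l}). (\<Prod>l\<in>UNIV. coeff (monom 1 (k l)) (j l)) * \<mu> j)"
    by (rule moment_functional_bound) (simp add: degree_monom_eq)
  also have "\<dots> = (\<Sum>j \<in> {k}. (\<Prod>l\<in>UNIV. coeff (monom 1 (k l)) (j l)) * \<mu> j)"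
  proof (rule sum.mono_neutral_right)
    show "finite (PiE UNIV (\<lambda>l. {..k l}))"
      by (intro finite_PiE) auto
    show "\<forall>j \<in> PiE UNIV (\<lambda>l. {..k l}) - {k}.
            (\<Prod>l\<in>UNIV. coeff (monom (1::real) (k l)) (j l)) * \<mu> j = 0"
    proof
      fix j assume "j \<in> PiE UNIV (\<lambda>l. {..k l}) - {k}"
      then obtain l where "j l \<noteq> k l" by blast
      then have "(\<Prod>l\<in>UNIV. coeff (monom (1::real) (k l)) (j l)) = 0"
        by (auto intro!: exI[of _ l])
      then show "(\<Prod>l\<in>UNIV. coeff (monom (1::real) (k l)) (j l)) * \<mu> j = 0"
        by simp
    qed
  qed auto
  finally show ?thesis by simp
qed

lemma moment_functional_linear:
  "moment_functional \<mu> (p(l := smult c q + r)) =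
     c * moment_functional \<mu> (p(l := q)) + moment_functional \<mu> (p(l := r))"
proof -
  define d where "d i = max (degree (p i)) (max (degree q) (degree r))" for i
  have prod: "(\<Prod>i\<in>UNIV. coeff ((p(l := x)) i) (k i)) =
      coeff x (k l) * (\<Prod>i\<in>UNIV - {l}. coeff (p i) (k i))" for x k
  proof -
    have "(\<Prod>i\<in>UNIV. coeff ((p(l := x)) i) (k i)) =
        coeff ((p(l := x)) l) (k l) * (\<Prod>i\<in>UNIV - {l}. coeff ((p(l := x)) i) (k i))"
      by (rule prod.remove) auto
    also have "(\<Prod>i\<in>UNIV - {l}. coeff ((p(l := x)) i) (k i)) =
        (\<Prod>i\<in>UNIV - {l}. coeff (p i) (k i))"
      by (rule prod.cong) auto
    finally show ?thesis by simp
  qed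
  have "degree (smult c q + r) \<le> max (degree q) (degree r)"
    using degree_add_le_max[of "smult c q" r] degree_smult_le[of c q] by linarith
  then have eq: "moment_functional \<mu> (p(l := x)) =
      (\<Sum>k \<in> PiE UNIV (\<lambda>l. {..d l}). (\<Prod>i\<in>UNIV. coeff ((p(l := x)) i) (k i)) * \<mu> k)"
    if "x \<in> {q, r, smult c q + r}" for x
    using that by (intro moment_functional_bound) (auto simp: d_def le_max_iff_disj)
  show ?thesis
    by (simp add: eq prod sum_distrib_left sum.distrib[symmetric] algebra_simps del: fun_upd_apply)
qed

definition bernstein_poly :: "nat \<Rightarrow> nat \<Rightarrow> real poly" where
  "bernstein_poly k m = smult (of_nat (k choose m)) (monom 1 m * [:1, -1:] ^ (k - m))"

definition bernstein_coeff ::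
  "(('n::finite \<Rightarrow> nat) \<Rightarrow> real) \<Rightarrow> ('n \<Rightarrow> nat) \<Rightarrow> ('n \<Rightarrow> nat) \<Rightarrow> real" where
  "bernstein_coeff \<mu> k m = moment_functional \<mu> (\<lambda>l. bernstein_poly (k l) (m l))"

text \<open>The first argument fixes the scalar field to which the numbers \<open>a l m\<close> belong.\<close>

definition weakly_bounded ::
  "'a::real_normed_field itself \<Rightarrow> (('n::finite \<Rightarrow> nat) \<Rightarrow> real) \<Rightarrow> bool" where
  "weakly_bounded K \<mu> \<longleftrightarrow>
     (\<exists>C>0. \<forall>k. \<forall>a :: 'n \<Rightarrow> nat \<Rightarrow> 'a.
        (\<forall>l. \<forall>m\<le>k l. norm (a l m) \<le> 1) \<longrightarrow>
        norm (\<Sum>m \<in> PiE UNIV (\<lambda>l. {..k l}).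
                (\<Prod>l\<in>UNIV. a l (m l)) * of_real (bernstein_coeff \<mu> k m)) \<le> C)"

end

theory Submission
  imports Defs "HOL-Probability.Probability"
begin

text \<open>
  From a solution to weak boundedness, evaluate \<open>\<gamma>\<close> on Bernstein polynomials through step
  functions on a uniform grid; a combination of Bernstein polynomials with coefficients in the unit
  ball is itself bounded by 1, so its integral is controlled by the semivariation.

  Conversely, weak boundedness makes \<open>L\<^sub>\<mu>\<close> a bounded multilinear functional on polynomials, which
  is extended to bounded Borel functions one variable at a time. In a single variable the extension
  is the Hausdorff moment theorem: the point masses \<open>L\<close> assigns to the Bernstein polynomials have
  uniformly bounded total variation, and Helly's selection theorem applied to their positive and
  negative parts yields a signed measure. The crux is that extending a further variable keeps
  \<open>\<sigma>\<close>-additivity in the variables extended before. This rests on the fact that a bounded bilinear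
  form on \<open>c\<^sub>0 \<times> c\<^sub>0\<close> has equal iterated sums, together with the uniqueness of the \<open>\<sigma>\<close>-additive
  extension of a functional on polynomials.
\<close>

subsection \<open>Iterated sums of bounded bilinear forms\<close>

text \<open>Weak boundedness tests the coefficients only against products of numbers that each
  depend on one index. For two or more variables the sum of the moduli of
  \<open>bernstein_coeff \<mu> k m\<close> over \<open>m\<close> may therefore be unbounded in
  \<open>k\<close>; there need be no measure on the cube to which a selection theorem could be
  applied, and this forces the passage through one variable at a time. The one-variable extension
  comes from convergent subsequences, selected anew for each setting of the other variables, so its
  construction alone gives no linear or \<sigma>-additive dependence on them. Uniqueness repairs
  this. For linearity it is enough to compare both sides on polynomials. For \<sigma>-additivity the
  sum of a series of functionals has to be known as \<sigma>-additive before it can be compared with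
  anything, and this is where two infinite sums must be exchanged under a bilinear bound, without
  absolute convergence of the double series. Each variable costs a factor 3 in the bound. The
  moments are real, so the functional is built over the reals and is extended to complex functions
  by components only at the end.\<close>

lemma blocks_vanish_uniformly:
  fixes x :: "nat \<Rightarrow> nat \<Rightarrow> real"
  assumes bound: "\<And>M a b. (\<And>j. \<bar>a j\<bar> \<le> 1) \<Longrightarrow> (\<And>k. \<bar>b k\<bar> \<le> 1) \<Longrightarrow>
      (\<Sum>j<M. \<Sum>k<M. a j * b k * x j k) \<le> K"
    and rows: "\<And>j. summable (x j)"
    and e: "0 < e"
  shows "\<exists>n0. \<forall>J n n'. n0 \<le> n \<longrightarrow> \<bar>\<Sum>j<J. \<Sum>k=n..<n'. x j k\<bar> \<le> e"
proof (rule ccontr)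
  assume "\<not> ?thesis"
  then have big: "\<exists>J n n'. n0 \<le> n \<and> e < \<bar>\<Sum>j<J. \<Sum>k=n..<n'. x j k\<bar>" for n0
    by (auto simp: not_le)
  \<comment> \<open>Gliding hump: finitely supported \<open>a\<close>, \<open>b\<close> in the unit
    balls on which the form is at least \<open>N * (e / 2)\<close>. Each round adds a block in fresh
    rows and fresh columns that contributes more than \<open>e / 2\<close>; for large
    \<open>N\<close> the total exceeds \<open>K\<close>.\<close>
  have "\<exists>M a b. (\<forall>j. \<bar>a j\<bar> \<le> 1) \<and> (\<forall>k. \<bar>b k\<bar> \<le> 1) \<and> (\<forall>j\<ge>M. a j = 0) \<and> (\<forall>k\<ge>M. b k = 0) \<and>
      real N * (e / 2) \<le> (\<Sum>j<M. \<Sum>k<M. a j * b k * x j k)" for N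
  proof (induction N)
    case 0
    show ?case by (rule exI[of _ 0], rule exI[of _ "\<lambda>_. 0"], rule exI[of _ "\<lambda>_. 0"]) simp
  next
    case (Suc N)
    then obtain M a b where a: "\<And>j. \<bar>a j\<bar> \<le> 1" and b: "\<And>k. \<bar>b k\<bar> \<le> 1"
      and a0: "\<And>j. j \<ge> M \<Longrightarrow> a j = 0" and b0: "\<And>k. k \<ge> M \<Longrightarrow> b k = 0"
      and le: "real N * (e / 2) \<le> (\<Sum>j<M. \<Sum>k<M. a j * b k * x j k)"
      by blast
    \<comment> \<open>The \<open>M\<close> old rows then contribute at most
      \<open>M * d \<le> e / 2\<close> to the new block, so more than \<open>e / 2\<close> is left
      for fresh rows. The \<open>+ 1\<close> covers \<open>M = 0\<close>.\<close>
    define d where "d = e / (2 * (real M + 1))"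
    have d: "0 < d" using e by (simp add: d_def)
    have "\<forall>\<^sub>F n1 in sequentially. \<forall>j\<in>{..<M}. \<forall>n\<ge>n1. \<forall>n'. \<bar>\<Sum>k=n..<n'. x j k\<bar> < d"
    proof (rule eventually_ball_finite)
      show "\<forall>j\<in>{..<M}. \<forall>\<^sub>F n1 in sequentially. \<forall>n\<ge>n1. \<forall>n'. \<bar>\<Sum>k=n..<n'. x j k\<bar> < d"
      proof
        fix j
        obtain N where N: "\<forall>m\<ge>N. \<forall>n. norm (sum (x j) {m..<n}) < d"
          using rows[of j] d unfolding summable_Cauchy by blast
        show "\<forall>\<^sub>F n1 in sequentially. \<forall>n\<ge>n1. \<forall>n'. \<bar>\<Sum>k=n..<n'. x j k\<bar> < d"
          using N by (intro eventually_sequentiallyI[of N]) auto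
      qed
    qed simp
    then obtain n1 where n1: "\<And>n1' j n n'. n1' \<ge> n1 \<Longrightarrow> j < M \<Longrightarrow> n \<ge> n1' \<Longrightarrow> \<bar>\<Sum>k=n..<n'. x j k\<bar> < d"
      unfolding eventually_sequentially by blast
    \<comment> \<open>\<open>n1 \<le> n\<close> makes the tails of the old rows small,
      \<open>M \<le> n\<close> keeps the new columns off the support of \<open>b\<close>.\<close>
    obtain J n n' where n: "max n1 M \<le> n" and J: "e < \<bar>\<Sum>j<J. \<Sum>k=n..<n'. x j k\<bar>"
      using big by blast
    define y where "y j = (\<Sum>k=n..<n'. x j k)" for j
    have small: "(\<Sum>j<min J M. y j) \<le> e / 2" "- (e / 2) \<le> (\<Sum>j<min J M. y j)"
    proof -
      have "\<bar>\<Sum>j<min J M. y j\<bar> \<le> (\<Sum>j<min J M. \<bar>y j\<bar>)" by (rule sum_abs)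
      also have "\<dots> \<le> (\<Sum>j<min J M. d)"
        using n1[of n1 _ n n'] n by (intro sum_mono) (auto simp: y_def less_imp_le)
      also have "\<dots> \<le> (real M + 1) * d"
        using d by (simp add: mult_right_mono)
      also have "\<dots> = e / 2" by (simp add: d_def field_simps add_nonneg_pos)
      finally show "(\<Sum>j<min J M. y j) \<le> e / 2" "- (e / 2) \<le> (\<Sum>j<min J M. y j)" by linarith+
    qed
    have split: "(\<Sum>j<J. y j) = (\<Sum>j<min J M. y j) + (\<Sum>j=M..<J. y j)"
    proof (cases "J \<le> M")
      case True then show ?thesis by simp
    next
      case False
      then have "{..<J} = {..<M} \<union> {M..<J}" "{..<M} \<inter> {M..<J} = {}" "min J M = M" by auto
      then show ?thesis by (simp add: sum.union_disjoint)
    qed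
    have block: "e / 2 < \<bar>\<Sum>j=M..<J. y j\<bar>"
      using J small split unfolding y_def by linarith
    define M' where "M' = max M (max J n')"
    define B where "B a b = (\<Sum>j<M'. \<Sum>k<M'. a j * b k * x j k)" for a b :: "nat \<Rightarrow> real"
    define u where "u j = (if M \<le> j \<and> j < J then sgn (\<Sum>j=M..<J. y j) else 0)" for j
    define v where "v k = (if n \<le> k \<and> k < n' then 1 else 0 :: real)" for k
    \<comment> \<open>The sign makes the mixed terms contribute nonnegatively, so that only the new diagonal block
      \<open>B u v\<close> counts.\<close>
    define s where "s = (if 0 \<le> B a v + B u b then 1 else - 1 :: real)"
    have s: "0 \<le> s * (B a v + B u b)" "s * s = 1" "\<bar>s\<bar> = 1"
      by (auto simp: s_def)
    have Bab: "B a b = (\<Sum>j<M. \<Sum>k<M. a j * b k * x j k)"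
    proof -
      have "(\<Sum>j<M. \<Sum>k<M. a j * b k * x j k) = (\<Sum>j<M. \<Sum>k<M'. a j * b k * x j k)"
        by (intro sum.cong refl sum.mono_neutral_left) (auto simp: M'_def b0)
      also have "\<dots> = B a b" unfolding B_def
        by (intro sum.mono_neutral_left) (auto simp: M'_def a0)
      finally show ?thesis ..
    qed
    have Buv: "B u v = \<bar>\<Sum>j=M..<J. y j\<bar>"
    proof -
      have "B u v = (\<Sum>j<M'. u j * y j)"
        unfolding B_def
      proof (intro sum.cong refl)
        fix j
        have "(\<Sum>k<M'. u j * v k * x j k) = (\<Sum>k=n..<n'. u j * v k * x j k)"
          by (intro sum.mono_neutral_right) (auto simp: M'_def v_def)
        also have "\<dots> = u j * y j" by (simp add: y_def v_def sum_distrib_left)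
        finally show "(\<Sum>k<M'. u j * v k * x j k) = u j * y j" .
      qed
      also have "\<dots> = (\<Sum>j=M..<J. u j * y j)"
        by (intro sum.mono_neutral_right) (auto simp: M'_def u_def)
      also have "\<dots> = sgn (\<Sum>j=M..<J. y j) * (\<Sum>j=M..<J. y j)"
        by (simp add: u_def sum_distrib_left)
      also have "\<dots> = \<bar>\<Sum>j=M..<J. y j\<bar>" by (simp add: abs_sgn mult.commute)
      finally show ?thesis .
    qed
    have "B (\<lambda>j. a j + s * u j) (\<lambda>k. b k + s * v k) = B a b + s * (B a v + B u b) + s * s * B u v"
      unfolding B_def by (simp add: algebra_simps sum.distrib sum_distrib_left)
    then have "real (Suc N) * (e / 2) \<le> B (\<lambda>j. a j + s * u j) (\<lambda>k. b k + s * v k)"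
      using s block le unfolding Bab Buv by (simp add: algebra_simps add_divide_distrib)
    moreover have "\<bar>a j + s * u j\<bar> \<le> 1" for j
      using a[of j] a0[of j] s(3) by (auto simp: u_def abs_mult sgn_if)
    moreover have "\<bar>b k + s * v k\<bar> \<le> 1" for k
      using b[of k] b0[of k] s(3) n by (auto simp: v_def)
    moreover have "\<forall>j\<ge>M'. a j + s * u j = 0" "\<forall>k\<ge>M'. b k + s * v k = 0"
      by (auto simp: M'_def a0 b0 u_def v_def)
    ultimately show ?case
      by (intro exI[of _ M'] exI[of _ "\<lambda>j. a j + s * u j"] exI[of _ "\<lambda>k. b k + s * v k"])
        (simp add: B_def)
  qed
  then have "real N * (e / 2) \<le> K" for N
    using bound by (meson order_trans)
  moreover obtain N where "K / (e / 2) < real N" using reals_Archimedean2 by blast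
  ultimately show False using e by (auto simp: field_simps not_less[symmetric])
qed

text \<open>\<open>R - (\<Sum>k<n. c k)\<close> is the limit, in \<open>n'\<close> and then in
  \<open>J\<close>, of the blocks with rows below \<open>J\<close> and columns from \<open>n\<close>
  up to \<open>n'\<close>. These are small uniformly in \<open>J\<close> and \<open>n'\<close>, so
  the smallness survives both limits.\<close>

lemma bounded_bilinear_iterated_sums:
  fixes x :: "nat \<Rightarrow> nat \<Rightarrow> real"
  assumes bound: "\<And>M a b. (\<And>j. \<bar>a j\<bar> \<le> 1) \<Longrightarrow> (\<And>k. \<bar>b k\<bar> \<le> 1) \<Longrightarrow>
      (\<Sum>j<M. \<Sum>k<M. a j * b k * x j k) \<le> K"
    and rows: "\<And>j. x j sums r j"
    and cols: "\<And>k. (\<lambda>j. x j k) sums c k"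
    and r: "r sums R"
  shows "c sums R"
proof -
  have "\<exists>n0. \<forall>n\<ge>n0. norm ((\<Sum>k<n. c k) - R) < e" if "0 < e" for e
  proof -
    have "0 < e / 2" using that by simp
    from blocks_vanish_uniformly[OF bound sums_summable[OF rows] this]
    obtain n0 where n0: "\<And>J n n'. n0 \<le> n \<Longrightarrow> \<bar>\<Sum>j<J. \<Sum>k=n..<n'. x j k\<bar> \<le> e / 2"
      by blast
    have "norm ((\<Sum>k<n. c k) - R) < e" if n: "n0 \<le> n" for n
    proof -
      have J: "\<bar>\<Sum>j<J. r j - (\<Sum>k<n. x j k)\<bar> \<le> e / 2" for J
      proof (rule LIMSEQ_le_const2)
        have "(\<lambda>n'. \<bar>\<Sum>j<J. (\<Sum>k<n'. x j k) - (\<Sum>k<n. x j k)\<bar>) \<longlonglongrightarrow>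
            \<bar>\<Sum>j<J. r j - (\<Sum>k<n. x j k)\<bar>"
          using rows by (intro tendsto_intros) (simp add: sums_def)
        then show "(\<lambda>n'. \<bar>\<Sum>j<J. (\<Sum>k<n'. x j k) - (\<Sum>k<n. x j k)\<bar>) \<longlonglongrightarrow>
            \<bar>\<Sum>j<J. r j - (\<Sum>k<n. x j k)\<bar>" .
        show "\<exists>N. \<forall>n'\<ge>N. \<bar>\<Sum>j<J. (\<Sum>k<n'. x j k) - (\<Sum>k<n. x j k)\<bar> \<le> e / 2"
        proof (intro exI[of _ n] allI impI)
          fix n' assume "n \<le> n'"
          then have "(\<Sum>k<n'. x j k) - (\<Sum>k<n. x j k) = (\<Sum>k=n..<n'. x j k)" for j
            using sum_diff_nat_ivl[of 0 n n' "x j"] by (simp add: atLeast0LessThan)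
          then show "\<bar>\<Sum>j<J. (\<Sum>k<n'. x j k) - (\<Sum>k<n. x j k)\<bar> \<le> e / 2"
            using n0[OF n] by simp
        qed
      qed
      have "(\<lambda>j. r j - (\<Sum>k<n. x j k)) sums (R - (\<Sum>k<n. c k))"
        using cols by (intro sums_diff r sums_sum) auto
      then have "(\<lambda>J. \<bar>\<Sum>j<J. r j - (\<Sum>k<n. x j k)\<bar>) \<longlonglongrightarrow> \<bar>R - (\<Sum>k<n. c k)\<bar>"
        unfolding sums_def by (rule tendsto_rabs)
      then have "\<bar>R - (\<Sum>k<n. c k)\<bar> \<le> e / 2"
        using J by (intro LIMSEQ_le_const2) auto
      then show ?thesis using \<open>0 < e\<close> by (simp add: abs_minus_commute)
    qed
    then show ?thesis by blast
  qed
  then show ?thesis unfolding sums_def by (rule LIMSEQ_I)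
qed

subsection \<open>Functionals on bounded Borel functions\<close>

text \<open>Only the values on the unit interval are bounded. A functional with a bound of the form
  \<open>K * c\<close> thus vanishes on functions that are zero there, and functions on the line can
  stand for functions on \<open>{0..1}\<close>. Strict positivity keeps products of bounds
  positive.\<close>

definition bounded_borel :: "real \<Rightarrow> (real \<Rightarrow> real) \<Rightarrow> bool" where
  "bounded_borel c f \<longleftrightarrow> 0 < c \<and> f \<in> borel_measurable borel \<and> (\<forall>t\<in>{0..1}. \<bar>f t\<bar> \<le> c)"

text \<open>Additivity is required along series with \<open>\<Sum>\<bar>g\<^sub>j\<bar> \<le> 1\<close> rather than along bounded pointwise
  convergent sequences: for such series it can be checked by exchanging iterated sums, and it still
  determines the functional by its values on polynomials.\<close>

definition borel_functional :: "real \<Rightarrow> ((real \<Rightarrow> real) \<Rightarrow> real) \<Rightarrow> bool" where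
  "borel_functional K \<Phi> \<longleftrightarrow>
     (\<forall>a c d g h. bounded_borel c g \<longrightarrow> bounded_borel d h \<longrightarrow>
        \<Phi> (\<lambda>t. a * g t + h t) = a * \<Phi> g + \<Phi> h) \<and>
     (\<forall>c g. bounded_borel c g \<longrightarrow> \<bar>\<Phi> g\<bar> \<le> K * c) \<and>
     (\<forall>g G. (\<forall>j. g j \<in> borel_measurable borel) \<longrightarrow> G \<in> borel_measurable borel \<longrightarrow>
        (\<forall>t\<in>{0..1}. \<forall>N. (\<Sum>j<N. \<bar>g j t\<bar>) \<le> 1) \<longrightarrow> (\<forall>t\<in>{0..1}. (\<lambda>j. g j t) sums G t) \<longrightarrow>
        (\<lambda>j::nat. \<Phi> (g j)) sums \<Phi> G)"

lemma borel_functional_lin: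
  "borel_functional K \<Phi> \<Longrightarrow> bounded_borel c g \<Longrightarrow> bounded_borel d h \<Longrightarrow>
    \<Phi> (\<lambda>t. a * g t + h t) = a * \<Phi> g + \<Phi> h"
  unfolding borel_functional_def by blast

lemma borel_functional_bound: "borel_functional K \<Phi> \<Longrightarrow> bounded_borel c g \<Longrightarrow> \<bar>\<Phi> g\<bar> \<le> K * c"
  unfolding borel_functional_def by blast

lemma borel_functional_sums:
  assumes "borel_functional K \<Phi>" "\<And>j. g j \<in> borel_measurable borel" "G \<in> borel_measurable borel"
    "\<And>t N. t \<in> {0..1} \<Longrightarrow> (\<Sum>j<N. \<bar>g j t\<bar>) \<le> 1" "\<And>t. t \<in> {0..1} \<Longrightarrow> (\<lambda>j. g j t) sums G t"
  shows "(\<lambda>j. \<Phi> (g j)) sums \<Phi> G"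
  using assms unfolding borel_functional_def by blast

lemma bounded_borel_lin:
  assumes "bounded_borel c g" "bounded_borel d h"
  shows "bounded_borel (\<bar>a\<bar> * c + d) (\<lambda>t. a * g t + h t)"
  using assms unfolding bounded_borel_def
proof (safe intro!: borel_measurable_add borel_measurable_times borel_measurable_const)
  assume "0 < c" "0 < d" then show "0 < \<bar>a\<bar> * c + d" by (simp add: add_nonneg_pos)
next
  fix t :: real assume t: "t \<in> {0..1}" "\<forall>t\<in>{0..1}. \<bar>g t\<bar> \<le> c" "\<forall>t\<in>{0..1}. \<bar>h t\<bar> \<le> d"
  have "\<bar>a * g t + h t\<bar> \<le> \<bar>a\<bar> * \<bar>g t\<bar> + \<bar>h t\<bar>" by (metis abs_mult abs_triangle_ineq)
  also have "\<dots> \<le> \<bar>a\<bar> * c + d" using t by (intro add_mono mult_left_mono) auto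
  finally show "\<bar>a * g t + h t\<bar> \<le> \<bar>a\<bar> * c + d" .
qed

lemma bounded_borel_continuous:
  assumes "continuous_on UNIV g" shows "\<exists>c. bounded_borel c g"
proof -
  have "bounded (g ` {0..1})"
    using assms by (intro compact_imp_bounded compact_continuous_image continuous_on_subset[OF assms]) auto
  then obtain c where "0 < c" "\<forall>x\<in>g ` {0..1}. norm x \<le> c" unfolding bounded_pos by blast
  then show ?thesis
    using assms by (intro exI[of _ c]) (auto simp: bounded_borel_def borel_measurable_continuous_onI)
qed

lemma bounded_borel_poly: "\<exists>c. bounded_borel c (poly p)"
  by (intro bounded_borel_continuous continuous_intros)

lemma bounded_borel_const: "0 < c \<Longrightarrow> \<bar>x\<bar> \<le> c \<Longrightarrow> bounded_borel c (\<lambda>t. x)"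
  by (auto simp: bounded_borel_def)

lemma bounded_borel_indicator: "A \<in> sets borel \<Longrightarrow> bounded_borel 1 (indicator A)"
  by (auto simp: bounded_borel_def indicator_def)

lemma bounded_borel_sum:
  assumes "finite F" "\<And>i. i \<in> F \<Longrightarrow> \<exists>c. bounded_borel c (g i)"
  shows "\<exists>c. bounded_borel c (\<lambda>t. \<Sum>i\<in>F. a i * g i t)"
  using assms
proof (induction F rule: finite_induct)
  case empty
  show ?case using bounded_borel_const[of 1 0] by auto
next
  case (insert x F)
  then obtain c d where "bounded_borel c (g x)" "bounded_borel d (\<lambda>t. \<Sum>i\<in>F. a i * g i t)" by blast
  from bounded_borel_lin[OF this, of "a x"] insert(1,2) show ?case by (auto simp: sum.insert)
qed

lemma abs_sums_le:
  fixes x :: "nat \<Rightarrow> real"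
  assumes "x sums y" "\<And>N. (\<Sum>j<N. \<bar>x j\<bar>) \<le> B"
  shows "\<bar>y\<bar> \<le> B"
proof (rule LIMSEQ_le_const2)
  show "(\<lambda>N. \<bar>\<Sum>j<N. x j\<bar>) \<longlonglongrightarrow> \<bar>y\<bar>"
    using assms(1) unfolding sums_def by (rule tendsto_rabs)
  have "\<bar>\<Sum>j<N. x j\<bar> \<le> B" for N
    by (rule order_trans[OF sum_abs assms(2)])
  then show "\<exists>N. \<forall>n\<ge>N. \<bar>\<Sum>j<n. x j\<bar> \<le> B" by blast
qed

lemma bounded_borel_summand:
  fixes g :: "nat \<Rightarrow> real \<Rightarrow> real"
  assumes "\<And>j. g j \<in> borel_measurable borel" "\<And>t N. t \<in> {0..1} \<Longrightarrow> (\<Sum>j<N. \<bar>g j t\<bar>) \<le> 1"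
  shows "bounded_borel 1 (g j)"
  unfolding bounded_borel_def
proof (intro conjI ballI)
  fix t :: real assume t: "t \<in> {0..1}"
  have "\<bar>g j t\<bar> \<le> (\<Sum>j<Suc j. \<bar>g j t\<bar>)" by (simp add: sum_nonneg)
  also have "\<dots> \<le> 1" using assms t by blast
  finally show "\<bar>g j t\<bar> \<le> 1" .
qed (use assms in auto)

lemma bounded_borel_sums:
  fixes g :: "nat \<Rightarrow> real \<Rightarrow> real"
  assumes "G \<in> borel_measurable borel" "\<And>t N. t \<in> {0..1} \<Longrightarrow> (\<Sum>j<N. \<bar>g j t\<bar>) \<le> 1"
    "\<And>t. t \<in> {0..1} \<Longrightarrow> (\<lambda>j. g j t) sums G t"
  shows "bounded_borel 1 G"
  unfolding bounded_borel_def
proof (intro conjI ballI)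
  fix t :: real assume "t \<in> {0..1}"
  then show "\<bar>G t\<bar> \<le> 1" using abs_sums_le[OF assms(3) assms(2)] by blast
qed (use assms in auto)

lemma sum_indicator_disjoint_le:
  fixes A :: "nat \<Rightarrow> 'b set"
  assumes "disjoint_family A"
  shows "(\<Sum>j<N. \<bar>indicator (A j) t\<bar>) \<le> (1 :: real)"
proof -
  have "(\<Sum>j<N. \<bar>indicator (A j) t\<bar>) = (\<Sum>j<N. indicator (A j) t :: real)" by simp
  also have "\<dots> = indicator (\<Union>i<N. A i) t"
    using assms by (intro indicator_UN_disjoint[symmetric]) (auto simp: disjoint_family_on_def)
  finally show ?thesis by (simp add: indicator_def)
qed

lemma borel_functional_zero: "borel_functional K \<Phi> \<Longrightarrow> \<Phi> (\<lambda>t. 0) = 0"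
  using borel_functional_lin[of K \<Phi> 1 "\<lambda>t. 0" 1 "\<lambda>t. 0" 1] bounded_borel_const[of 1 0] by simp

lemma borel_functional_sum:
  assumes "borel_functional K \<Phi>" "finite F" "\<And>i. i \<in> F \<Longrightarrow> \<exists>c. bounded_borel c (g i)"
  shows "\<Phi> (\<lambda>t. \<Sum>i\<in>F. a i * g i t) = (\<Sum>i\<in>F. a i * \<Phi> (g i))"
  using assms(2,3)
proof (induction F rule: finite_induct)
  case empty
  show ?case using borel_functional_zero[OF assms(1)] by simp
next
  case (insert x F)
  then obtain c d where "bounded_borel c (g x)" "bounded_borel d (\<lambda>t. \<Sum>i\<in>F. a i * g i t)"
    using bounded_borel_sum[of F g a] by blast
  from borel_functional_lin[OF assms(1) this, of "a x"] insert show ?case by (simp add: sum.insert)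
qed

text \<open>With \<open>a = - 1\<close> a difference of two functionals becomes available to the
  uniqueness argument; with other coefficients, two integrals and a point evaluation are assembled
  into one functional.\<close>

lemma borel_functional_lin_comb:
  assumes "borel_functional K \<Phi>" "borel_functional L \<Psi>"
  shows "borel_functional (\<bar>a\<bar> * K + L) (\<lambda>g. a * \<Phi> g + \<Psi> g)"
  unfolding borel_functional_def
proof (intro conjI allI impI)
  fix b c d g h assume "bounded_borel c g" "bounded_borel d h"
  then show "a * \<Phi> (\<lambda>t. b * g t + h t) + \<Psi> (\<lambda>t. b * g t + h t) =
      b * (a * \<Phi> g + \<Psi> g) + (a * \<Phi> h + \<Psi> h)"
    using borel_functional_lin[OF assms(1)] borel_functional_lin[OF assms(2)]
    by (simp add: algebra_simps)
next
  fix c g assume g: "bounded_borel c g"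
  have "\<bar>a * \<Phi> g + \<Psi> g\<bar> \<le> \<bar>a\<bar> * \<bar>\<Phi> g\<bar> + \<bar>\<Psi> g\<bar>" by (metis abs_mult abs_triangle_ineq)
  also have "\<dots> \<le> \<bar>a\<bar> * (K * c) + L * c"
    using borel_functional_bound[OF assms(1) g] borel_functional_bound[OF assms(2) g]
    by (intro add_mono mult_left_mono) auto
  finally show "\<bar>a * \<Phi> g + \<Psi> g\<bar> \<le> (\<bar>a\<bar> * K + L) * c" by (simp add: algebra_simps)
next
  fix g :: "nat \<Rightarrow> real \<Rightarrow> real" and G
  assume g: "\<forall>j. g j \<in> borel_measurable borel" "G \<in> borel_measurable borel"
    "\<forall>t\<in>{0..1}. \<forall>N. (\<Sum>j<N. \<bar>g j t\<bar>) \<le> 1" "\<forall>t\<in>{0..1}. (\<lambda>j. g j t) sums G t"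
  have "(\<lambda>j. \<Phi> (g j)) sums \<Phi> G" "(\<lambda>j. \<Psi> (g j)) sums \<Psi> G"
    using borel_functional_sums[OF assms(1), of g G] borel_functional_sums[OF assms(2), of g G] g by blast+
  then show "(\<lambda>j. a * \<Phi> (g j) + \<Psi> (g j)) sums (a * \<Phi> G + \<Psi> G)"
    by (intro sums_add sums_mult)
qed

lemma poly_bernstein_poly: "poly (bernstein_poly k m) t = Bernstein k m t"
  by (simp add: bernstein_poly_def Bernstein_def poly_monom algebra_simps)

section \<open>Uniqueness of the extension from polynomials\<close>

lemma borel_functional_eq_0_limit:
  assumes \<Phi>: "borel_functional K \<Phi>" and g: "bounded_borel c g"
    and approx: "\<And>e. 0 < e \<Longrightarrow> \<exists>h d. bounded_borel d h \<and> \<Phi> h = 0 \<and> (\<forall>t\<in>{0..1}. \<bar>g t - h t\<bar> \<le> e)"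
  shows "\<Phi> g = 0"
proof -
  have le: "\<bar>\<Phi> g\<bar> \<le> K * e" if e: "0 < e" for e
  proof -
    obtain h d where h: "bounded_borel d h" "\<Phi> h = 0" "\<forall>t\<in>{0..1}. \<bar>g t - h t\<bar> \<le> e"
      using approx[OF e] by blast
    have "bounded_borel e (\<lambda>t. - 1 * h t + g t)"
      using h e g by (auto simp: bounded_borel_def)
    from borel_functional_bound[OF \<Phi> this] show ?thesis
      using borel_functional_lin[OF \<Phi> h(1) g, of "- 1"] h(2) by simp
  qed
  show ?thesis
  proof (rule ccontr)
    assume "\<Phi> g \<noteq> 0"
    then have K: "0 < K" using le[of 1] by simp
    then show False using le[of "\<bar>\<Phi> g\<bar> / (2 * K)"] \<open>\<Phi> g \<noteq> 0\<close> by simp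
  qed
qed

text \<open>The kernel is enlarged in stages: continuous functions by Weierstrass approximation,
  half-lines by series of continuous functions, Borel sets by a Dynkin class argument, bounded Borel
  functions by uniform approximation with step functions. Each series that occurs has absolute
  partial sums at most 1, as \<open>borel_functional\<close> demands.\<close>

lemma borel_functional_eq_0:
  assumes \<Phi>: "borel_functional K \<Phi>" and poly: "\<And>p. \<Phi> (poly p) = 0" and g: "bounded_borel c g"
  shows "\<Phi> g = 0"
proof -
  have cont: "\<Phi> h = 0" if h: "continuous_on UNIV h" for h
  proof -
    obtain d where "bounded_borel d h" using bounded_borel_continuous[OF h] by blast
    then show ?thesis
    proof (rule borel_functional_eq_0_limit[OF \<Phi>])
      fix e :: real assume "0 < e"
      then obtain n where n: "\<And>t. t \<in> {0..1} \<Longrightarrow> \<bar>h t - (\<Sum>k\<le>n. h (k / n) * Bernstein n k t)\<bar> < e"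
        using Bernstein_Weierstrass[OF continuous_on_subset[OF h subset_UNIV], of e] by auto
      define p where "p = (\<Sum>k\<le>n. smult (h (k / n)) (bernstein_poly n k))"
      have "poly p t = (\<Sum>k\<le>n. h (k / n) * Bernstein n k t)" for t
        by (simp add: p_def poly_sum poly_bernstein_poly)
      then show "\<exists>q d. bounded_borel d q \<and> \<Phi> q = 0 \<and> (\<forall>t\<in>{0..1}. \<bar>h t - q t\<bar> \<le> e)"
        using n poly[of p] bounded_borel_poly[of p] by (intro exI[of _ "poly p"]) (auto intro: less_imp_le)
    qed
  qed
  have half: "\<Phi> (indicator {..a}) = 0" for a
  proof -
    \<comment> \<open>Continuous ramps that decrease from the constant 1 at \<open>j = 0\<close> to
      the indicator of \<open>{..a}\<close>. Their successive differences are nonnegative and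
      telescope to \<open>1 - h N t\<close>, which is at most 1; a monotone limit becomes an
      admissible series.\<close>
    define h where "h j t = max 0 (min 1 (1 - real j * (t - a)))" for j t
    have one: "h j t = 1" if "t \<le> a" for j t
      using mult_nonneg_nonpos[of "real j" "t - a"] that by (simp add: h_def)
    have h01: "0 \<le> h j t" "h 0 t = 1" for j t
      by (simp_all add: h_def)
    have mono: "h (Suc j) t \<le> h j t" for j t
    proof (cases "t \<le> a")
      case False
      then have "real j * (t - a) \<le> real (Suc j) * (t - a)" by (intro mult_right_mono) auto
      then show ?thesis unfolding h_def by (intro max.mono min.mono order.refl) linarith
    qed (simp add: one)
    have tele: "(\<Sum>j<N. h j t - h (Suc j) t) = 1 - h N t" for N t
      using sum_lessThan_telescope'[of "\<lambda>j. h j t" N] h01(2) by simp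
    have lim: "(\<lambda>j. h j t) \<longlonglongrightarrow> indicator {..a} t" for t
    proof (cases "t \<le> a")
      case True
      then show ?thesis by (simp add: one)
    next
      case False
      obtain N :: nat where N: "1 / (t - a) < real N" using reals_Archimedean2 by blast
      have "h j t = 0" if "N \<le> j" for j
      proof -
        have "1 / (t - a) \<le> real j" using N that by linarith
        then have "1 \<le> real j * (t - a)" using False by (simp add: field_simps)
        then show ?thesis by (simp add: h_def)
      qed
      then have "eventually (\<lambda>j. h j t = 0) sequentially" by (rule eventually_sequentiallyI)
      then show ?thesis using False by (simp add: tendsto_eventually)
    qed
    have "(\<lambda>j. \<Phi> (\<lambda>t. h j t - h (Suc j) t)) sums \<Phi> (\<lambda>t. 1 - indicator {..a} t)"
    proof (rule borel_functional_sums[OF \<Phi>])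
      fix t :: real and N
      have "(\<Sum>j<N. \<bar>h j t - h (Suc j) t\<bar>) = 1 - h N t" using mono by (simp add: tele)
      then show "(\<Sum>j<N. \<bar>h j t - h (Suc j) t\<bar>) \<le> 1" using h01(1)[of N t] by simp
      show "(\<lambda>j. h j t - h (Suc j) t) sums (1 - indicator {..a} t)"
        unfolding sums_def tele by (intro tendsto_intros lim)
    qed (auto simp: h_def)
    moreover have "\<Phi> (\<lambda>t. h j t - h (Suc j) t) = 0" for j
      unfolding h_def by (intro cont continuous_intros)
    ultimately have "\<Phi> (\<lambda>t. 1 - indicator {..a} t) = 0"
      using sums_unique2[OF _ sums_zero] by simp
    moreover have "\<Phi> (\<lambda>t. 1) = 0" by (intro cont continuous_intros)
    moreover have "\<Phi> (\<lambda>t. - 1 * indicator {..a} t + 1) = - 1 * \<Phi> (indicator {..a}) + \<Phi> (\<lambda>t. 1)"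
      by (rule borel_functional_lin[OF \<Phi> bounded_borel_indicator bounded_borel_const[of 1]]) auto
    ultimately show ?thesis by simp
  qed
  have sets: "\<Phi> (indicator A) = 0" if "A \<in> sets borel" for A
  proof -
    have A: "A \<in> sigma_sets UNIV (range atMost)"
      using that by (simp add: borel_eq_atMost)
    have stable: "Int_stable (range (atMost :: real \<Rightarrow> _))"
      by (auto simp: Int_stable_def)
    have Pow: "range (atMost :: real \<Rightarrow> _) \<subseteq> Pow UNIV" by simp
    from stable Pow A show ?thesis
    proof (induction rule: sigma_sets_induct_disjoint)
      case (basic A) then show ?case using half by auto
    next
      case empty show ?case using borel_functional_zero[OF \<Phi>] by (simp add: indicator_def)
    next
      case (compl A)
      then have A: "A \<in> sets borel" by (simp add: borel_eq_atMost)
      have "\<Phi> (\<lambda>t. - 1 * indicator A t + 1) = - 1 * \<Phi> (indicator A) + \<Phi> (\<lambda>t. 1)"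
        by (rule borel_functional_lin[OF \<Phi> bounded_borel_indicator[OF A] bounded_borel_const[of 1]]) auto
      moreover have "(\<lambda>t. - 1 * indicator A t + 1) = (indicator (UNIV - A) :: real \<Rightarrow> real)"
        by (auto simp: indicator_def)
      moreover have "\<Phi> (\<lambda>t. 1) = 0" by (intro cont continuous_intros)
      ultimately show ?case using compl by simp
    next
      case (union A)
      then have A: "A i \<in> sets borel" for i
        using range_subsetD[OF union(2)] by (simp add: borel_eq_atMost)
      have "(\<lambda>j. \<Phi> (indicator (A j))) sums \<Phi> (indicator (\<Union>i. A i))"
      proof (rule borel_functional_sums[OF \<Phi>])
        fix t :: real and N
        show "(\<lambda>j. indicator (A j) t :: real) sums indicator (\<Union>i. A i) t"
          using union(1) by (intro indicator_sums) (auto simp: disjoint_family_on_def)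
        show "(\<Sum>j<N. \<bar>indicator (A j) t\<bar>) \<le> (1 :: real)"
          using union(1) by (rule sum_indicator_disjoint_le)
      qed (use A in auto)
      then show ?case using union(3) sums_unique2[OF _ sums_zero] by simp
    qed
  qed
  show ?thesis
    using g
  proof (rule borel_functional_eq_0_limit[OF \<Phi>])
    fix e :: real assume e: "0 < e"
    \<comment> \<open>On the unit interval \<open>\<lfloor>g t / e\<rfloor>\<close> then lies
      between \<open>- N\<close> and \<open>N\<close>, so finitely many level sets describe
      \<open>g\<close> up to \<open>e\<close>.\<close>
    obtain N :: nat where N: "c / e + 1 < real N" using reals_Archimedean2 by blast
    define A where "A i = {t. \<lfloor>g t / e\<rfloor> = i}" for i
    define h where "h t = (\<Sum>i\<in>{- int N..int N}. (e * of_int i) * indicator (A i) t)" for t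
    have [measurable]: "g \<in> borel_measurable borel" using g by (simp add: bounded_borel_def)
    have A: "A i \<in> sets borel" for i unfolding A_def by measurable
    have "\<exists>d. bounded_borel d h" unfolding h_def
      by (intro bounded_borel_sum exI[of _ 1] bounded_borel_indicator A) auto
    moreover have "\<Phi> h = (\<Sum>i\<in>{- int N..int N}. (e * of_int i) * \<Phi> (indicator (A i)))"
      unfolding h_def
      by (intro borel_functional_sum[OF \<Phi>] exI[of _ 1] bounded_borel_indicator A) auto
    then have "\<Phi> h = 0" using sets[OF A] by simp
    moreover have "\<bar>g t - h t\<bar> \<le> e" if t: "t \<in> {0..1}" for t
    proof -
      have "\<bar>g t\<bar> \<le> c" using g t by (simp add: bounded_borel_def)
      then have "\<bar>g t / e\<bar> \<le> c / e" using e by (simp add: divide_right_mono)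
      then have "- real N \<le> g t / e" "g t / e < real N + 1"
        using N unfolding abs_le_iff by linarith+
      then have "\<lfloor>g t / e\<rfloor> \<in> {- int N..int N}" by (simp add: le_floor_iff floor_le_iff)
      then have "h t = e * of_int \<lfloor>g t / e\<rfloor>"
        unfolding h_def A_def indicator_def by (simp add: if_distrib[of "\<lambda>x. _ * x"] cong: if_cong)
      moreover have "0 \<le> g t / e - of_int \<lfloor>g t / e\<rfloor>" "g t / e - of_int \<lfloor>g t / e\<rfloor> \<le> 1"
        by linarith+
      then have "0 \<le> e * (g t / e - of_int \<lfloor>g t / e\<rfloor>)" "e * (g t / e - of_int \<lfloor>g t / e\<rfloor>) \<le> e * 1"
        using e by (intro mult_nonneg_nonneg mult_left_mono; simp)+
      ultimately show ?thesis using e by (simp add: right_diff_distrib)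
    qed
    ultimately show "\<exists>h d. bounded_borel d h \<and> \<Phi> h = 0 \<and> (\<forall>t\<in>{0..1}. \<bar>g t - h t\<bar> \<le> e)" by blast
  qed
qed

lemma borel_functional_eqI:
  assumes \<Phi>: "borel_functional K \<Phi>" and \<Psi>: "borel_functional L \<Psi>"
    and "\<And>p. \<Phi> (poly p) = \<Psi> (poly p)" "bounded_borel c g"
  shows "\<Phi> g = \<Psi> g"
  using borel_functional_eq_0[OF borel_functional_lin_comb[OF \<Phi> \<Psi>, of "- 1"]] assms(3,4) by fastforce

subsection \<open>The moment problem in one variable\<close>

text \<open>The identity \<open>(k choose m) * (m choose j) = (k choose j) * ((k - j) choose (m -
  j))\<close> turns the sum into \<open>t ^ j\<close> times the binomial expansion of
  \<open>(t + (1 - t)) ^ (k - j)\<close>.\<close>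

lemma monom_eq_bernstein_sum:
  fixes t :: real
  assumes "j \<le> k"
  shows "(\<Sum>m\<le>k. real (m choose j) / real (k choose j) * poly (bernstein_poly k m) t) = t ^ j"
proof -
  have pos: "0 < real (k choose j)" using assms by simp
  have "(\<Sum>m\<le>k. real (m choose j) / real (k choose j) * poly (bernstein_poly k m) t) =
      (\<Sum>m\<in>{j..k}. real ((k - j) choose (m - j)) * t ^ m * (1 - t) ^ (k - m))"
  proof (rule sum.mono_neutral_cong_right)
    fix m assume m: "m \<in> {j..k}"
    have "real (k choose m) * real (m choose j) = real (k choose j) * real ((k - j) choose (m - j))"
      using m choose_mult[of j m k] unfolding of_nat_mult[symmetric] by simp
    then show "real (m choose j) / real (k choose j) * poly (bernstein_poly k m) t =
        real ((k - j) choose (m - j)) * t ^ m * (1 - t) ^ (k - m)"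
      using pos by (simp add: bernstein_poly_def poly_monom divide_simps) (simp add: algebra_simps)
  qed auto
  also have "\<dots> = (\<Sum>i\<le>k - j. real ((k - j) choose i) * t ^ (i + j) * (1 - t) ^ (k - (i + j)))"
    using assms by (intro sum.reindex_bij_witness[of _ "\<lambda>i. i + j" "\<lambda>m. m - j"]) auto
  also have "\<dots> = t ^ j * (\<Sum>i\<le>k - j. real ((k - j) choose i) * t ^ i * (1 - t) ^ (k - j - i))"
    by (simp add: sum_distrib_left power_add algebra_simps diff_diff_add)
  also have "(\<Sum>i\<le>k - j. real ((k - j) choose i) * t ^ i * (1 - t) ^ (k - j - i)) = 1"
    using binomial_ring[of t "1 - t" "k - j"] by simp
  finally show ?thesis by simp
qed

text \<open>Both terms are products of \<open>j\<close> factors of modulus at most 1,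
  \<open>m / k\<close> against \<open>(m - i) / (k - i)\<close>; two such products differ by at most
  the sum of the differences of their factors.\<close>

lemma choose_ratio_approx:
  assumes "m \<le> k" "2 * j \<le> k" "j < k"
  shows "\<bar>(real m / real k) ^ j - real (m choose j) / real (k choose j)\<bar> \<le> real j * real j / real (k - j)"
proof -
  have ratio: "real (m choose j) / real (k choose j) = (\<Prod>i<j. (real m - real i) / (real k - real i))"
  proof -
    have "real (m choose j) / real (k choose j) =
        ((\<Prod>i<j. real m - real i) / fact j) / ((\<Prod>i<j. real k - real i) / fact j)"
      by (simp add: binomial_gbinomial gbinomial_prod_rev atLeast0LessThan)
    also have "\<dots> = (\<Prod>i<j. real m - real i) / (\<Prod>i<j. real k - real i)" by simp
    finally show ?thesis by (simp add: prod_dividef)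
  qed
  have fac: "norm ((real m - real i) / (real k - real i)) \<le> 1"
    "norm (real m / real k - (real m - real i) / (real k - real i)) \<le> real j / real (k - j)" if i: "i < j" for i
  proof -
    have k: "0 < real k - real i" "0 < real k" using i assms by auto
    \<comment> \<open>For \<open>m < i\<close> the left side is \<open>i - m\<close>, and
      \<open>2 * j \<le> k\<close> keeps it at most \<open>k - i\<close>.\<close>
    have "\<bar>real m - real i\<bar> \<le> real k - real i" using i assms by auto
    then show "norm ((real m - real i) / (real k - real i)) \<le> 1"
      using k by (simp add: abs_divide)
    have "real m / real k - (real m - real i) / (real k - real i) =
        (real i * (real k - real m) / real k) / (real k - real i)"
      using k by (simp add: divide_simps) (simp add: algebra_simps)
    moreover have "\<bar>(real i * (real k - real m) / real k) / (real k - real i)\<bar> \<le> real j / real (k - j)"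
    proof -
      have "real i * (real k - real m) \<le> real j * real k" using i assms by (intro mult_mono) auto
      then have "real i * (real k - real m) / real k \<le> real j" using k by (simp add: divide_simps)
      then have "(real i * (real k - real m) / real k) / (real k - real i) \<le> real j / real (k - j)"
        using i assms by (intro frac_le) auto
      then show ?thesis using k assms by simp
    qed
    ultimately show "norm (real m / real k - (real m - real i) / (real k - real i)) \<le> real j / real (k - j)"
      by simp
  qed
  have "norm ((\<Prod>i<j. real m / real k) - (\<Prod>i<j. (real m - real i) / (real k - real i))) \<le>
      (\<Sum>i<j. norm (real m / real k - (real m - real i) / (real k - real i)))"
    using fac(1) assms by (intro norm_prod_diff) auto
  also have "\<dots> \<le> (\<Sum>i<j. real j / real (k - j))"
    using fac(2) by (intro sum_mono) auto
  finally show ?thesis by (simp add: ratio)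
qed

text \<open>The weights become point masses at the nodes \<open>m / k\<close>. All these
  distributions live on \<open>{- 1<..1}\<close>, which is open on the left and so has to start
  below the node 0; tightness is immediate. The prescribed subsequence \<open>s\<close> permits a
  second selection inside a first one.\<close>

lemma helly_selection_nodes:
  fixes v :: "nat \<Rightarrow> nat \<Rightarrow> real"
  assumes v: "\<And>k m. 0 \<le> v k m" "\<And>k. (\<Sum>m\<le>k. v k m) = 1" and s: "strict_mono s"
  shows "\<exists>r P. strict_mono (r :: nat \<Rightarrow> nat) \<and> real_distribution P \<and>
    (\<forall>f B. (\<forall>x. isCont f x) \<longrightarrow> (\<forall>x. \<bar>f x\<bar> \<le> B) \<longrightarrow>
      (\<lambda>n. \<Sum>m\<le>s (r n). v (s (r n)) m * f (real m / real (s (r n)))) \<longlonglongrightarrow> (\<integral>x. f x \<partial>P))"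
proof -
  define D where "D k = distr (point_measure {..k} (v k)) borel (\<lambda>m. real m / real k)" for k
  have prob: "prob_space (point_measure {..k} (v k))" for k
    by (rule prob_spaceI) (simp add: space_point_measure emeasure_point_measure_finite v)
  have D: "real_distribution (D k)" for k
    unfolding D_def by (intro prob_space.real_distribution_distr prob) simp
  have integral: "(\<integral>x. f x \<partial>D k) = (\<Sum>m\<le>k. v k m * f (real m / real k))"
    if "f \<in> borel_measurable borel" for f :: "real \<Rightarrow> real" and k
    unfolding D_def using that
    by (subst integral_distr) (simp_all add: lebesgue_integral_point_measure_finite v)
  have unit: "measure (D k) {- 1<..1} = 1" for k
  proof -
    have "measure (D k) {- 1<..1} = (\<integral>x. indicator {- 1<..1} x \<partial>D k)"
      using D[of k] by (simp add: real_distribution.events_eq_borel)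
    also have "\<dots> = (\<Sum>m\<le>k. v k m * indicator {- 1<..1} (real m / real k))"
      by (rule integral) simp
    also have "\<dots> = (\<Sum>m\<le>k. v k m)"
      by (intro sum.cong refl) (auto simp: indicator_def divide_le_eq_1 less_le_trans[of "-1" 0])
    finally show ?thesis by (simp add: v)
  qed
  have "tight D"
    unfolding tight_def
  proof (intro conjI allI impI D)
    fix e :: real assume "0 < e"
    then have "- 1 < (1 :: real) \<and> (\<forall>n. 1 - e < measure (D n) {- 1<..1})" by (simp add: unit)
    then show "\<exists>a b. a < b \<and> (\<forall>n. 1 - e < measure (D n) {a<..b})" by blast
  qed
  then obtain r P where r: "strict_mono (r :: nat \<Rightarrow> nat)" and P: "real_distribution P"
    and conv: "weak_conv_m (D \<circ> s \<circ> r) P"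
    using tight_imp_convergent_subsubsequence s by blast
  interpret P: real_distribution P by fact
  have "(\<lambda>n. \<Sum>m\<le>s (r n). v (s (r n)) m * f (real m / real (s (r n)))) \<longlonglongrightarrow> (\<integral>x. f x \<partial>P)"
    if f: "\<forall>x. isCont f x" "\<forall>x. \<bar>f x\<bar> \<le> B" for f :: "real \<Rightarrow> real" and B
  proof -
    have "(\<lambda>n. \<integral>x. f x \<partial>D (s (r n))) \<longlonglongrightarrow> (\<integral>x. f x \<partial>P)"
      using f D P conv[unfolded comp_def]
      by (intro weak_conv_imp_integral_bdd_continuous_conv[where B = B]) auto
    moreover have "f \<in> borel_measurable borel"
      using f by (intro borel_measurable_continuous_onI continuous_at_imp_continuous_on) auto
    ultimately show ?thesis by (simp add: integral)
  qed
  then show ?thesis using r P by blast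
qed

lemma poly_functional_monoms:
  fixes L :: "real poly \<Rightarrow> real"
  assumes lin: "\<And>a p q. L (smult a p + q) = a * L p + L q"
  shows "L p = (\<Sum>i\<le>degree p. coeff p i * L (monom 1 i))"
proof -
  have 0: "L 0 = 0" using lin[of 1 0 0] by simp
  have "L (\<Sum>i\<in>F. monom (a i) i) = (\<Sum>i\<in>F. a i * L (monom 1 i))" if "finite F" for F a
    using that
  proof induction
    case (insert x F)
    then show ?case using lin[of "a x" "monom 1 x" "\<Sum>i\<in>F. monom (a i) i"]
      by (simp add: smult_monom)
  qed (simp add: 0)
  from this[of "{..degree p}" "coeff p"] show ?thesis by (simp add: poly_as_sum_of_monoms)
qed

lemma poly_functional_sum:
  fixes L :: "real poly \<Rightarrow> real"
  assumes lin: "\<And>a p q. L (smult a p + q) = a * L p + L q" and "finite F"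
  shows "L (\<Sum>i\<in>F. smult (a i) (p i)) = (\<Sum>i\<in>F. a i * L (p i))"
  using assms(2)
proof induction
  case empty
  show ?case using lin[of 1 0 0] by simp
qed (simp add: lin)

text \<open>The exact expansion of \<open>monom 1 j\<close> has the coefficients
  \<open>(m choose j) / (k choose j)\<close>, which differ from \<open>(m / k) ^ j\<close> by O(1 /
  k), while the moduli of \<open>L (bernstein_poly k m)\<close> sum over \<open>m \<le> k\<close> to
  at most \<open>K\<close>. Hence weak limits of the point masses have the moments of
  \<open>L\<close>.\<close>

lemma bernstein_sum_tendsto:
  fixes L :: "real poly \<Rightarrow> real"
  assumes lin: "\<And>a p q. L (smult a p + q) = a * L p + L q"
    and bound: "\<And>k a. (\<And>m. \<bar>a m\<bar> \<le> 1) \<Longrightarrow> \<bar>\<Sum>m\<le>k. a m * L (bernstein_poly k m)\<bar> \<le> K"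
  shows "(\<lambda>k. \<Sum>m\<le>k. (real m / real k) ^ j * L (bernstein_poly k m)) \<longlonglongrightarrow> L (monom 1 j)"
proof (rule LIM_zero_cancel, rule Lim_null_comparison)
  \<comment> \<open>\<open>bound\<close> scaled to coefficients of size \<open>d\<close>. It asks
    for a bound at every index, hence the value 0 beyond \<open>k\<close> in the proof.\<close>
  have K: "\<bar>\<Sum>m\<le>k. a m * L (bernstein_poly k m)\<bar> \<le> K * d"
    if a: "\<And>m. m \<le> k \<Longrightarrow> \<bar>a m\<bar> \<le> d" and d: "0 < d" for k a d
  proof -
    have "\<bar>\<Sum>m\<le>k. (if m \<le> k then a m / d else 0) * L (bernstein_poly k m)\<bar> \<le> K"
      using a d by (intro bound) (auto simp: divide_le_eq)
    also have "(\<Sum>m\<le>k. (if m \<le> k then a m / d else 0) * L (bernstein_poly k m)) =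
        (\<Sum>m\<le>k. a m * L (bernstein_poly k m)) / d"
      by (simp add: sum_divide_distrib)
    finally show ?thesis using d by (simp add: abs_divide divide_le_eq)
  qed
  show "\<forall>\<^sub>F k in sequentially. norm ((\<Sum>m\<le>k. (real m / real k) ^ j * L (bernstein_poly k m)) - L (monom 1 j))
      \<le> K * ((real j + 1) * (real j + 1) / (real k - real j))"
  proof (rule eventually_sequentiallyI)
    fix k assume k: "2 * j + 1 \<le> k"
    have "monom 1 j = (\<Sum>m\<le>k. smult (real (m choose j) / real (k choose j)) (bernstein_poly k m))"
      using monom_eq_bernstein_sum[of j k] k
      by (intro poly_eq_poly_eq_iff[THEN iffD1] ext) (simp add: poly_sum poly_monom)
    then have "L (monom 1 j) = (\<Sum>m\<le>k. real (m choose j) / real (k choose j) * L (bernstein_poly k m))"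
      using poly_functional_sum[of L "{..k}" "\<lambda>m. real (m choose j) / real (k choose j)" "bernstein_poly k", OF lin]
      by simp
    then have "(\<Sum>m\<le>k. (real m / real k) ^ j * L (bernstein_poly k m)) - L (monom 1 j) =
        (\<Sum>m\<le>k. ((real m / real k) ^ j - real (m choose j) / real (k choose j)) * L (bernstein_poly k m))"
      by (simp add: sum_subtractf left_diff_distrib)
    \<comment> \<open>\<open>j + 1\<close> in place of \<open>j\<close> keeps this bound strictly
      positive for \<open>j = 0\<close>, as the scaling requires.\<close>
    also have "\<bar>\<dots>\<bar> \<le> K * ((real j + 1) * (real j + 1) / (real k - real j))"
    proof (rule K)
      fix m assume "m \<le> k"
      then have "\<bar>(real m / real k) ^ j - real (m choose j) / real (k choose j)\<bar> \<le> real j * real j / real (k - j)"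
        using k by (intro choose_ratio_approx) auto
      also have "\<dots> \<le> (real j + 1) * (real j + 1) / (real k - real j)"
        using k by (intro frac_le mult_mono) (auto simp: of_nat_diff)
      finally show "\<bar>(real m / real k) ^ j - real (m choose j) / real (k choose j)\<bar>
          \<le> (real j + 1) * (real j + 1) / (real k - real j)" .
    qed (use k in \<open>auto intro!: divide_pos_pos mult_pos_pos\<close>)
    finally show "norm ((\<Sum>m\<le>k. (real m / real k) ^ j * L (bernstein_poly k m)) - L (monom 1 j))
      \<le> K * ((real j + 1) * (real j + 1) / (real k - real j))" by simp
  qed
  show "(\<lambda>k. K * ((real j + 1) * (real j + 1) / (real k - real j))) \<longlonglongrightarrow> 0"
    by real_asymp
qed

text \<open>Weak convergence is tested with bounded continuous functions on the whole line, where
  the limit measure lives as well. Composition with this retraction turns monomials into such test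
  functions and pushes the limit measure forward to the unit interval.\<close>

definition clamp01 :: "real \<Rightarrow> real" where
  "clamp01 t = max 0 (min 1 t)"

lemma clamp01_mem: "clamp01 t \<in> {0..1}" and clamp01_id: "t \<in> {0..1} \<Longrightarrow> clamp01 t = t"
  by (auto simp: clamp01_def)

lemma borel_measurable_clamp01[measurable]: "clamp01 \<in> borel_measurable borel"
  unfolding clamp01_def by measurable

lemma borel_functional_integral:
  assumes "prob_space P" and sets: "sets P = sets borel"
  shows "borel_functional 1 (\<lambda>f. \<integral>t. f (clamp01 t) \<partial>P)"
proof -
  interpret prob_space P by fact
  have meas: "(\<lambda>t. g (clamp01 t)) \<in> borel_measurable P" if "g \<in> borel_measurable borel" for g :: "real \<Rightarrow> real"
    using that measurable_compose[OF borel_measurable_clamp01 that] by (simp add: measurable_cong_sets[OF sets refl])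
  have int: "integrable P (\<lambda>t. g (clamp01 t))" if "bounded_borel c g" for c g
    using that clamp01_mem by (intro integrable_const_bound[of _ c] meas) (auto simp: bounded_borel_def)
  show ?thesis
    unfolding borel_functional_def
  proof (intro conjI allI impI)
    fix a c d g h assume "bounded_borel c g" "bounded_borel d h"
    then show "(\<integral>t. a * g (clamp01 t) + h (clamp01 t) \<partial>P) =
        a * (\<integral>t. g (clamp01 t) \<partial>P) + (\<integral>t. h (clamp01 t) \<partial>P)"
      using int by simp
  next
    fix c g assume g: "bounded_borel c g"
    have "\<bar>\<integral>t. g (clamp01 t) \<partial>P\<bar> \<le> (\<integral>t. \<bar>g (clamp01 t)\<bar> \<partial>P)" by (rule integral_abs_bound)
    also have "\<dots> \<le> (\<integral>t. c \<partial>P)"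
      using g int[OF g] clamp01_mem by (intro integral_mono) (auto simp: bounded_borel_def)
    finally show "\<bar>\<integral>t. g (clamp01 t) \<partial>P\<bar> \<le> 1 * c" by (simp add: prob_space)
  next
    fix g :: "nat \<Rightarrow> real \<Rightarrow> real" and G
    assume g: "\<forall>j. g j \<in> borel_measurable borel" "G \<in> borel_measurable borel"
      "\<forall>t\<in>{0..1}. \<forall>N. (\<Sum>j<N. \<bar>g j t\<bar>) \<le> 1" "\<forall>t\<in>{0..1}. (\<lambda>j. g j t) sums G t"
    have bb: "bounded_borel 1 (g j)" for j
      by (rule bounded_borel_summand) (use g in auto)
    have "(\<lambda>N. \<integral>t. (\<Sum>j<N. g j (clamp01 t)) \<partial>P) \<longlonglongrightarrow> (\<integral>t. G (clamp01 t) \<partial>P)"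
    proof (rule integral_dominated_convergence[where w = "\<lambda>_. 1"])
      show "AE t in P. (\<lambda>N. \<Sum>j<N. g j (clamp01 t)) \<longlonglongrightarrow> G (clamp01 t)"
        using g clamp01_mem by (auto simp: sums_def)
      have "\<bar>\<Sum>j<N. g j (clamp01 t)\<bar> \<le> 1" for N t
        using g(3) clamp01_mem[of t] sum_abs[of "\<lambda>j. g j (clamp01 t)" "{..<N}"] by (meson order_trans)
      then show "AE t in P. norm (\<Sum>j<N. g j (clamp01 t)) \<le> 1" for N by simp
      show "(\<lambda>t. \<Sum>j<N. g j (clamp01 t)) \<in> borel_measurable P" for N
        using g meas by (intro borel_measurable_sum) auto
    qed (use g meas in auto)
    then show "(\<lambda>j. \<integral>t. g j (clamp01 t) \<partial>P) sums (\<integral>t. G (clamp01 t) \<partial>P)"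
      unfolding sums_def by (simp add: int[OF bb])
  qed
qed

lemma borel_functional_eval: "t \<in> {0..1} \<Longrightarrow> borel_functional 1 (\<lambda>f. f t)"
  unfolding borel_functional_def by (auto simp: bounded_borel_def)

lemma borel_functional_0: "borel_functional 0 (\<lambda>f. 0)"
  unfolding borel_functional_def by simp

lemma borel_functional_mono:
  assumes "borel_functional K \<Phi>" "K \<le> K'"
  shows "borel_functional K' \<Phi>"
proof -
  have "\<bar>\<Phi> g\<bar> \<le> K' * c" if g: "bounded_borel c g" for c g
  proof -
    have "\<bar>\<Phi> g\<bar> \<le> K * c" using assms(1) g by (rule borel_functional_bound)
    also have "\<dots> \<le> K' * c" using assms(2) g by (intro mult_right_mono) (auto simp: bounded_borel_def)
    finally show ?thesis .
  qed
  then show ?thesis using assms(1) unfolding borel_functional_def by blast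
qed

text \<open>The constant \<open>3 * K\<close> consists of \<open>K\<close> for each of two
  probability measures scaled by \<open>K\<close>, and \<open>\<bar>L 1\<bar> \<le> K\<close> for a
  point evaluation at 0. Division by \<open>K\<close> makes the padded parts probability weights,
  the form in which the selection theorem for distributions applies.\<close>

lemma borel_functional_extension:
  fixes L :: "real poly \<Rightarrow> real"
  assumes lin: "\<And>a p q. L (smult a p + q) = a * L p + L q"
    and bound: "\<And>k a. (\<And>m. \<bar>a m\<bar> \<le> 1) \<Longrightarrow> \<bar>\<Sum>m\<le>k. a m * L (bernstein_poly k m)\<bar> \<le> K"
    and K: "0 < K"
  shows "\<exists>\<Phi>. borel_functional (3 * K) \<Phi> \<and> (\<forall>p. \<Phi> (poly p) = L p)"
proof -
  define w where "w k m = L (bernstein_poly k m)" for k m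
  \<comment> \<open>Both parts are padded at 0 to mass \<open>K\<close>; the paddings differ by \<open>- L 1\<close> whatever \<open>k\<close> is, so
    the term \<open>L 1 * f 0\<close> in \<open>\<Phi>\<close> compensates them.\<close>
  define v where "v \<sigma> k m = (max 0 (\<sigma> * w k m) + (if m = 0 then K - (\<Sum>m\<le>k. max 0 (\<sigma> * w k m)) else 0)) / K"
    for \<sigma> k m
  have mass: "(\<Sum>m\<le>k. max 0 (\<sigma> * w k m)) \<le> K" if "\<sigma> \<in> {1, - 1}" for \<sigma> k
  proof -
    \<comment> \<open>Coefficients equal to \<open>\<sigma>\<close> where the sign agrees and to 0
      elsewhere pick out exactly the part in question.\<close>
    have "(\<Sum>m\<le>k. max 0 (\<sigma> * w k m)) = (\<Sum>m\<le>k. (if 0 \<le> \<sigma> * w k m then \<sigma> else 0) * L (bernstein_poly k m))"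
      by (intro sum.cong refl) (auto simp: w_def)
    also have "\<dots> \<le> K" using that by (intro order_trans[OF abs_ge_self bound]) auto
    finally show ?thesis .
  qed
  have v0: "0 \<le> v \<sigma> k m" if "\<sigma> \<in> {1, - 1}" for \<sigma> k m
    unfolding v_def using mass[OF that] K by (intro divide_nonneg_pos add_nonneg_nonneg) auto
  have v_sum: "(\<Sum>m\<le>k. v \<sigma> k m * f m) =
      ((\<Sum>m\<le>k. max 0 (\<sigma> * w k m) * f m) + (K - (\<Sum>m\<le>k. max 0 (\<sigma> * w k m))) * f 0) / K" for \<sigma> k f
    by (simp add: v_def sum_divide_distrib[symmetric] add_divide_distrib distrib_right sum.distrib
        if_distrib[of "\<lambda>x. x / K"] if_distrib[of "\<lambda>x. x * _"] cong: if_cong)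
  have K_v_sum: "K * (\<Sum>m\<le>k. v \<sigma> k m * f m) =
      (\<Sum>m\<le>k. max 0 (\<sigma> * w k m) * f m) + (K - (\<Sum>m\<le>k. max 0 (\<sigma> * w k m))) * f 0" for \<sigma> k f
    unfolding v_sum using K by simp
  have v1: "(\<Sum>m\<le>k. v \<sigma> k m) = 1" for \<sigma> k
    using v_sum[of \<sigma> k "\<lambda>_. 1"] K by simp
  obtain r1 P where r1: "strict_mono (r1 :: nat \<Rightarrow> nat)" and P: "real_distribution P"
    and limP: "\<And>f B. (\<forall>x. isCont f x) \<Longrightarrow> (\<forall>x. \<bar>f x\<bar> \<le> B) \<Longrightarrow>
      (\<lambda>n. \<Sum>m\<le>r1 n. v 1 (r1 n) m * f (real m / real (r1 n))) \<longlonglongrightarrow> (\<integral>x. f x \<partial>P)"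
    using helly_selection_nodes[of "v 1" id, OF v0 v1 strict_mono_id] unfolding id_apply by blast
  \<comment> \<open>The second selection runs inside the first subsequence, so both parts converge
    along \<open>r1 \<circ> r2\<close>.\<close>
  obtain r2 Q where r2: "strict_mono (r2 :: nat \<Rightarrow> nat)" and Q: "real_distribution Q"
    and limQ: "\<And>f B. (\<forall>x. isCont f x) \<Longrightarrow> (\<forall>x. \<bar>f x\<bar> \<le> B) \<Longrightarrow>
      (\<lambda>n. \<Sum>m\<le>r1 (r2 n). v (- 1) (r1 (r2 n)) m * f (real m / real (r1 (r2 n)))) \<longlonglongrightarrow> (\<integral>x. f x \<partial>Q)"
    using helly_selection_nodes[of "v (- 1)" r1, OF v0 v1 r1] by blast
  define r where "r = r1 \<circ> r2"
  have r: "strict_mono r" unfolding r_def using r1 r2 by (rule strict_mono_o)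
  have one: "L 1 = (\<Sum>m\<le>k. w k m)" for k
  proof -
    have "1 = (\<Sum>m\<le>k. smult 1 (bernstein_poly k m))"
      by (intro poly_eq_poly_eq_iff[THEN iffD1] ext) (simp add: poly_sum poly_bernstein_poly)
    then show ?thesis
      using poly_functional_sum[of L "{..k}" "\<lambda>_. 1" "bernstein_poly k", OF lin] by (simp add: w_def)
  qed
  \<comment> \<open>The \<open>+ 0\<close> gives the expression the nested shape to which
    \<open>borel_functional_lin_comb\<close> applies repeatedly.\<close>
  define \<Phi> where "\<Phi> f = K * (\<integral>t. f (clamp01 t) \<partial>P) + (- K * (\<integral>t. f (clamp01 t) \<partial>Q) + (L 1 * f 0 + 0))"
    for f :: "real \<Rightarrow> real"
  have "\<bar>L 1\<bar> \<le> K"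
    using bound[of "\<lambda>_. 1" 0] one[of 0] by (simp add: w_def)
  have prob: "prob_space P" "sets P = sets borel" "prob_space Q" "sets Q = sets borel"
    using P Q by (simp_all add: real_distribution_def real_distribution_axioms_def)
  have "borel_functional (\<bar>K\<bar> * 1 + (\<bar>- K\<bar> * 1 + (\<bar>L 1\<bar> * 1 + 0))) \<Phi>"
    unfolding \<Phi>_def
    by (intro borel_functional_lin_comb borel_functional_integral borel_functional_eval borel_functional_0 prob) simp
  then have \<Phi>: "borel_functional (3 * K) \<Phi>"
    by (rule borel_functional_mono) (use \<open>\<bar>L 1\<bar> \<le> K\<close> K in simp)
  have monom: "\<Phi> (\<lambda>t. t ^ j) = L (monom 1 j)" for j
  proof -
    define f where "f t = clamp01 t ^ j" for t
    have f: "\<forall>x. isCont f x" "\<forall>x. \<bar>f x\<bar> \<le> 1"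
      unfolding f_def clamp01_def by (auto intro!: continuous_intros simp: power_le_one)
    have eq: "(\<Sum>m\<le>k. (real m / real k) ^ j * w k m) =
        K * (\<Sum>m\<le>k. v 1 k m * f (real m / real k)) + (- K * (\<Sum>m\<le>k. v (- 1) k m * f (real m / real k))
          + L 1 * f 0)" for k
    proof -
      have max: "w k m = max 0 (1 * w k m) - max 0 (- 1 * w k m)" for m by simp
      have "K * (\<Sum>m\<le>k. v 1 k m * f (real m / real k)) - K * (\<Sum>m\<le>k. v (- 1) k m * f (real m / real k)) =
          ((\<Sum>m\<le>k. max 0 (1 * w k m) * f (real m / real k)) - (\<Sum>m\<le>k. max 0 (- 1 * w k m) * f (real m / real k)))
           - ((\<Sum>m\<le>k. max 0 (1 * w k m)) - (\<Sum>m\<le>k. max 0 (- 1 * w k m))) * f 0"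
        unfolding K_v_sum by (simp add: algebra_simps)
      also have "\<dots> = (\<Sum>m\<le>k. w k m * f (real m / real k)) - (\<Sum>m\<le>k. w k m) * f 0"
        unfolding sum_subtractf[symmetric] left_diff_distrib[symmetric] by (subst (3 5) max) simp
      finally have "(\<Sum>m\<le>k. w k m * f (real m / real k)) =
        K * (\<Sum>m\<le>k. v 1 k m * f (real m / real k)) + (- K * (\<Sum>m\<le>k. v (- 1) k m * f (real m / real k))
          + L 1 * f 0)" by (simp add: one[of k])
      moreover have "f (real m / real k) = (real m / real k) ^ j" if "m \<le> k" for m
        unfolding f_def using that by (subst clamp01_id) (auto simp: divide_le_eq_1)
      ultimately show ?thesis by (simp add: mult.commute)
    qed
    have "(\<lambda>n. \<Sum>m\<le>r n. (real m / real (r n)) ^ j * w (r n) m) \<longlonglongrightarrow> L (monom 1 j)"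
      using LIMSEQ_subseq_LIMSEQ[OF bernstein_sum_tendsto[of L K, OF lin bound] r]
      by (simp add: w_def comp_def)
    moreover have "(\<lambda>n. \<Sum>m\<le>r n. (real m / real (r n)) ^ j * w (r n) m) \<longlonglongrightarrow>
        K * (\<integral>x. f x \<partial>P) + (- K * (\<integral>x. f x \<partial>Q) + L 1 * f 0)"
      unfolding eq using LIMSEQ_subseq_LIMSEQ[OF limP[OF f] r2] limQ[OF f]
      by (intro tendsto_intros) (simp_all add: r_def comp_def)
    ultimately have "L (monom 1 j) = K * (\<integral>x. f x \<partial>P) + (- K * (\<integral>x. f x \<partial>Q) + L 1 * f 0)"
      by (rule LIMSEQ_unique)
    then show ?thesis by (simp add: \<Phi>_def f_def clamp01_id)
  qed
  have "\<Phi> (poly p) = L p" for p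
  proof -
    have "\<Phi> (poly p) = \<Phi> (\<lambda>t. \<Sum>i\<le>degree p. coeff p i * t ^ i)"
      by (simp add: poly_altdef[abs_def])
    also have "\<dots> = (\<Sum>i\<le>degree p. coeff p i * \<Phi> (\<lambda>t. t ^ i))"
      by (intro borel_functional_sum[OF \<Phi>] bounded_borel_continuous continuous_intros) simp
    finally show ?thesis using poly_functional_monoms[of L p, OF lin] by (simp add: monom)
  qed
  then show ?thesis using \<Phi> by blast
qed

subsection \<open>Extension in several variables\<close>

text \<open>The series \<open>\<Phi> h = (\<Sum>j. \<Psi> (g j) h)\<close> agrees with
  \<open>\<Psi> G\<close> on polynomials, so uniqueness gives the claim once \<open>\<Phi>\<close>
  is \<sigma>-additive. Let \<open>u k\<close> be a series to be tested. Since the partial sums of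
  \<open>\<bar>g j t\<bar>\<close> and of \<open>\<bar>u k t\<bar>\<close> are at most 1, the matrix
  \<open>\<Psi> (g j) (u k)\<close> is a bilinear form bounded by \<open>K\<close>, and its iterated
  sums agree.\<close>

lemma bilinear_functional_sums:
  fixes \<Psi> :: "(real \<Rightarrow> real) \<Rightarrow> (real \<Rightarrow> real) \<Rightarrow> real"
  assumes lin: "\<And>a c d e g g' h. bounded_borel c g \<Longrightarrow> bounded_borel d g' \<Longrightarrow> bounded_borel e h \<Longrightarrow>
      \<Psi> (\<lambda>t. a * g t + g' t) h = a * \<Psi> g h + \<Psi> g' h"
    and functional: "\<And>c g. bounded_borel c g \<Longrightarrow> borel_functional (K * c) (\<Psi> g)"
    and g: "\<And>j. g j \<in> borel_measurable borel" "G \<in> borel_measurable borel"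
      "\<And>t N. t \<in> {0..1} \<Longrightarrow> (\<Sum>j<N. \<bar>g j t\<bar>) \<le> 1" "\<And>t. t \<in> {0..1} \<Longrightarrow> (\<lambda>j. g j t) sums G t"
    and poly: "\<And>p. (\<lambda>j. \<Psi> (g j) (poly p)) sums \<Psi> G (poly p)"
    and h: "bounded_borel e h"
  shows "(\<lambda>j::nat. \<Psi> (g j) h) sums \<Psi> G h"
proof -
  have comb: "bounded_borel 1 (\<lambda>t. \<Sum>j<N. a j * g' j t)"
    if g': "\<And>j. g' j \<in> borel_measurable borel" "\<And>t N. t \<in> {0..1} \<Longrightarrow> (\<Sum>j<N. \<bar>g' j t\<bar>) \<le> 1"
      and a: "\<And>j. \<bar>a j\<bar> \<le> 1" for a N and g' :: "nat \<Rightarrow> real \<Rightarrow> real"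
    unfolding bounded_borel_def
  proof (intro conjI ballI)
    fix t :: real assume t: "t \<in> {0..1}"
    have "\<bar>\<Sum>j<N. a j * g' j t\<bar> \<le> (\<Sum>j<N. \<bar>a j * g' j t\<bar>)" by (rule sum_abs)
    also have "\<dots> \<le> (\<Sum>j<N. \<bar>g' j t\<bar>)"
      using a by (intro sum_mono) (simp add: abs_mult mult_left_le_one_le)
    also have "\<dots> \<le> 1" using g'(2) t by blast
    finally show "\<bar>\<Sum>j<N. a j * g' j t\<bar> \<le> 1" .
  qed (use g' in simp_all)
  have G: "bounded_borel 1 G"
    by (rule bounded_borel_sums[OF g(2), of g]) (use g in auto)
  have gb: "bounded_borel 1 (g j)" for j
    by (rule bounded_borel_summand) (use g in auto)
  have gcomb: "bounded_borel 1 (\<lambda>t. \<Sum>j<N. a j * g j t)" if "\<And>j. \<bar>a j\<bar> \<le> 1" for a N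
    by (rule comb) (use g that in auto)
  have sum: "\<Psi> (\<lambda>t. \<Sum>j<N. a j * g j t) h = (\<Sum>j<N. a j * \<Psi> (g j) h)"
    if a: "\<And>j. \<bar>a j\<bar> \<le> 1" and h: "bounded_borel e h" for a N h e
  proof (induction N)
    case 0
    show ?case
      using lin[OF bounded_borel_const[of 1 0] bounded_borel_const[of 1 0] h, of 1] by simp
  next
    case (Suc N)
    have "bounded_borel 1 (\<lambda>t. \<Sum>j<N. a j * g j t)" "bounded_borel 1 (g N)"
      by (rule gcomb[OF a], rule gb)
    then show ?case
      using lin[OF _ _ h, of 1 "g N" 1 "\<lambda>t. \<Sum>j<N. a j * g j t" "a N"] Suc by (simp add: add.commute)
  qed
  \<comment> \<open>Signs as coefficients turn the sum of moduli into a single value of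
    \<open>\<Psi>\<close>, at a first argument bounded by 1.\<close>
  have abs: "(\<Sum>j<N. \<bar>\<Psi> (g j) h\<bar>) \<le> K * e" if h: "bounded_borel e h" for h e N
  proof -
    have "(\<Sum>j<N. \<bar>\<Psi> (g j) h\<bar>) = \<Psi> (\<lambda>t. \<Sum>j<N. sgn (\<Psi> (g j) h) * g j t) h"
      by (subst sum[OF _ h]) (auto simp: abs_sgn sgn_if mult.commute)
    also have "\<dots> \<le> K * 1 * e"
      by (intro order_trans[OF abs_ge_self borel_functional_bound[OF functional h]] gcomb)
        (auto simp: sgn_if)
    finally show ?thesis by simp
  qed
  have summable_abs: "summable (\<lambda>j. \<bar>\<Psi> (g j) h\<bar>)" if "bounded_borel e h" for h e
    by (rule summableI_nonneg_bounded[OF _ abs[OF that]]) simp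
  have summable: "summable (\<lambda>j. \<Psi> (g j) h)" if "bounded_borel e h" for h e
    using summable_rabs_cancel[OF summable_abs[OF that]] .
  define \<Phi> where "\<Phi> h = (\<Sum>j. \<Psi> (g j) h)" for h
  have sums: "(\<lambda>j. \<Psi> (g j) h) sums \<Phi> h" if "bounded_borel e h" for h e
    unfolding \<Phi>_def by (rule summable_sums[OF summable[OF that]])
  have fg: "borel_functional K (\<Psi> (g j))" for j
    using functional[OF gb] by simp
  have "borel_functional K \<Phi>"
    unfolding borel_functional_def
  proof (intro conjI allI impI)
    fix a c d u v assume uv: "bounded_borel c u" "bounded_borel d v"
    have "(\<lambda>j. a * \<Psi> (g j) u + \<Psi> (g j) v) sums (a * \<Phi> u + \<Phi> v)"
      by (intro sums_add sums_mult sums[OF uv(1)] sums[OF uv(2)])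
    then have "(\<lambda>j. \<Psi> (g j) (\<lambda>t. a * u t + v t)) sums (a * \<Phi> u + \<Phi> v)"
      using borel_functional_lin[OF fg uv] by simp
    then show "\<Phi> (\<lambda>t. a * u t + v t) = a * \<Phi> u + \<Phi> v"
      using sums[OF bounded_borel_lin[OF uv]] sums_unique2 by blast
  next
    fix c u assume u: "bounded_borel c u"
    have "\<bar>\<Phi> u\<bar> \<le> (\<Sum>j. \<bar>\<Psi> (g j) u\<bar>)"
      unfolding \<Phi>_def by (rule summable_rabs[OF summable_abs[OF u]])
    also have "\<dots> \<le> K * c"
      by (rule suminf_le_const[OF summable_abs[OF u] abs[OF u]])
    finally show "\<bar>\<Phi> u\<bar> \<le> K * c" .
  next
    fix u :: "nat \<Rightarrow> real \<Rightarrow> real" and U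
    assume u: "\<forall>j. u j \<in> borel_measurable borel" "U \<in> borel_measurable borel"
      "\<forall>t\<in>{0..1}. \<forall>N. (\<Sum>j<N. \<bar>u j t\<bar>) \<le> 1" "\<forall>t\<in>{0..1}. (\<lambda>j. u j t) sums U t"
    have su: "bounded_borel 1 (u k)" for k by (rule bounded_borel_summand) (use u in auto)
    have rows: "(\<lambda>k. \<Psi> (g j) (u k)) sums \<Psi> (g j) U" for j
      using borel_functional_sums[OF fg, of u U] u by blast
    have U: "bounded_borel 1 U"
      by (rule bounded_borel_sums[OF u(2), of u]) (use u in auto)
    \<comment> \<open>Rows are indexed by \<open>j\<close> and summed by \<sigma>-additivity of
      \<open>\<Psi> (g j)\<close>; the column sums are \<open>\<Phi> (u k)\<close> by
      definition.\<close>
    show "(\<lambda>k. \<Phi> (u k)) sums \<Phi> U"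
    proof (rule bounded_bilinear_iterated_sums[OF _ rows sums[OF su] sums[OF U]])
      fix M and a b :: "nat \<Rightarrow> real" assume a: "\<And>j. \<bar>a j\<bar> \<le> 1" and b: "\<And>k. \<bar>b k\<bar> \<le> 1"
      have w: "bounded_borel 1 (\<lambda>t. \<Sum>k<M. b k * u k t)"
        by (rule comb) (use u b in auto)
      have "(\<Sum>j<M. \<Sum>k<M. a j * b k * \<Psi> (g j) (u k)) = (\<Sum>j<M. a j * (\<Sum>k<M. b k * \<Psi> (g j) (u k)))"
        by (simp add: sum_distrib_left mult.assoc)
      also have "\<dots> = (\<Sum>j<M. a j * \<Psi> (g j) (\<lambda>t. \<Sum>k<M. b k * u k t))"
        using su by (subst borel_functional_sum[OF fg]) auto
      also have "\<dots> = \<Psi> (\<lambda>t. \<Sum>j<M. a j * g j t) (\<lambda>t. \<Sum>k<M. b k * u k t)"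
        by (rule sum[OF a w, symmetric])
      also have "\<dots> \<le> K * 1 * 1"
        by (intro order_trans[OF abs_ge_self borel_functional_bound[OF functional w]] gcomb a)
      finally show "(\<Sum>j<M. \<Sum>k<M. a j * b k * \<Psi> (g j) (u k)) \<le> K * 1 * 1" .
    qed
  qed
  moreover have "\<Phi> (poly p) = \<Psi> G (poly p)" for p
    using poly[of p] by (simp add: \<Phi>_def sums_iff)
  ultimately have "\<Phi> h = \<Psi> G h"
    by (rule borel_functional_eqI[OF _ functional[OF G] _ h])
  then show ?thesis using sums[OF h] by simp
qed

text \<open>The domains \<open>X l\<close> are arbitrary so that one expansion serves three
  situations: functionals on tuples of functions, the moment functional on polynomials, and
  polymeasures, where disjoint unions replace linear combinations. Coordinates are expanded one by
  one, and the induction keeps the remaining entries \<open>x\<close> arbitrary.\<close>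

lemma multilinear_expand:
  fixes G :: "('n::finite \<Rightarrow> 'x) \<Rightarrow> 'v::comm_ring_1"
  assumes step: "\<And>x l. (\<And>m. x m \<in> X m) \<Longrightarrow> G (x(l := u l)) = (\<Sum>j\<in>J l. c l j * G (x(l := v l j)))"
    and u: "\<And>l. u l \<in> X l" and v: "\<And>l j. j \<in> J l \<Longrightarrow> v l j \<in> X l"
  shows "G u = (\<Sum>k\<in>PiE UNIV J. (\<Prod>l\<in>UNIV. c l (k l)) * G (\<lambda>l. v l (k l)))"
proof -
  have "G (\<lambda>l. if l \<in> A then u l else x l) =
      (\<Sum>k\<in>PiE A J. (\<Prod>l\<in>A. c l (k l)) * G (\<lambda>l. if l \<in> A then v l (k l) else x l))"
    if "finite A" "\<And>m. x m \<in> X m" for A x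
    using that
  proof (induction A arbitrary: x rule: finite_induct)
    case empty
    show ?case by simp
  next
    case (insert i A)
    let ?y = "\<lambda>l. if l \<in> A then u l else x l"
    have "G (\<lambda>l. if l \<in> insert i A then u l else x l) = G (?y(i := u i))"
      by (rule arg_cong[of _ _ G]) auto
    also have "\<dots> = (\<Sum>j\<in>J i. c i j * G (?y(i := v i j)))"
      using insert.prems u by (intro step) auto
    also have "\<dots> = (\<Sum>j\<in>J i. c i j * G (\<lambda>l. if l \<in> A then u l else (x(i := v i j)) l))"
      using insert.hyps by (intro sum.cong refl arg_cong2[of _ _ _ _ "(*)"] arg_cong[of _ _ G]) auto
    also have "\<dots> = (\<Sum>j\<in>J i. c i j * (\<Sum>k\<in>PiE A J. (\<Prod>l\<in>A. c l (k l)) *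
        G (\<lambda>l. if l \<in> A then v l (k l) else (x(i := v i j)) l)))"
      using insert.prems v by (intro sum.cong refl arg_cong2[of _ _ _ _ "(*)"] insert.IH) auto
    also have "\<dots> = (\<Sum>(j, k)\<in>J i \<times> PiE A J. c i j * ((\<Prod>l\<in>A. c l (k l)) *
        G (\<lambda>l. if l \<in> A then v l (k l) else (x(i := v i j)) l)))"
      by (simp add: sum_distrib_left sum.cartesian_product)
    also have "\<dots> = (\<Sum>(j, k)\<in>J i \<times> PiE A J. (\<Prod>l\<in>insert i A. c l ((k(i := j)) l)) *
        G (\<lambda>l. if l \<in> insert i A then v l ((k(i := j)) l) else x l))"
    proof (intro sum.cong refl, clarify)
      fix j k
      have "(\<Prod>l\<in>insert i A. c l ((k(i := j)) l)) = c i j * (\<Prod>l\<in>A. c l (k l))"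
        using insert.hyps by (simp add: prod.insert) (intro arg_cong2[of _ _ _ _ "(*)"] refl prod.cong; auto)
      moreover have "(\<lambda>l. if l \<in> A then v l (k l) else (x(i := v i j)) l) =
          (\<lambda>l. if l \<in> insert i A then v l ((k(i := j)) l) else x l)"
        using insert.hyps by auto
      ultimately show "c i j * ((\<Prod>l\<in>A. c l (k l)) *
        G (\<lambda>l. if l \<in> A then v l (k l) else (x(i := v i j)) l)) = (\<Prod>l\<in>insert i A. c l ((k(i := j)) l)) *
        G (\<lambda>l. if l \<in> insert i A then v l ((k(i := j)) l) else x l)"
        by (simp only: mult.assoc)
    qed
    also have "\<dots> = (\<Sum>k\<in>PiE (insert i A) J. (\<Prod>l\<in>insert i A. c l (k l)) *
        G (\<lambda>l. if l \<in> insert i A then v l (k l) else x l))"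
      unfolding PiE_insert_eq using insert.hyps
      by (subst sum.reindex[OF inj_combinator]) (auto intro!: sum.cong)
    finally show ?case .
  qed
  from this[of UNIV u] u show ?thesis by simp
qed

section \<open>Functionals on tuples of bounded Borel functions and polynomials\<close>

definition test_fun :: "bool \<Rightarrow> (real \<Rightarrow> real) \<Rightarrow> bool" where
  "test_fun b f \<longleftrightarrow> (if b then \<exists>c. bounded_borel c f else f \<in> range poly)"

text \<open>A polynomial is measured by Bernstein coefficients and not by its supremum because
  coefficients are what weak boundedness tests. The degree \<open>k\<close> of the representation
  may be chosen freely.\<close>

definition test_bound :: "bool \<Rightarrow> real \<Rightarrow> (real \<Rightarrow> real) \<Rightarrow> bool" where
  "test_bound b c f \<longleftrightarrow>
     (if b then bounded_borel c f
      else 0 < c \<and> (\<exists>k a. (\<forall>m. \<bar>a m\<bar> \<le> c) \<and> f = (\<lambda>t. \<Sum>m\<le>k. a m * poly (bernstein_poly k m) t)))"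

text \<open>\<open>T\<close> acts on tuples with bounded Borel functions in the variables of \<open>S\<close> and polynomials in
  the others; polynomials are bounded through their coefficients in Bernstein bases.\<close>

definition moment_extension ::
  "'n set \<Rightarrow> real \<Rightarrow> (('n::finite \<Rightarrow> nat) \<Rightarrow> real) \<Rightarrow> (('n \<Rightarrow> real \<Rightarrow> real) \<Rightarrow> real) \<Rightarrow> bool" where
  "moment_extension S K \<mu> T \<longleftrightarrow>
     (\<forall>f l a g h. (\<forall>m. test_fun (m \<in> S) (f m)) \<longrightarrow> test_fun (l \<in> S) g \<longrightarrow> test_fun (l \<in> S) h \<longrightarrow>
        T (f(l := \<lambda>t. a * g t + h t)) = a * T (f(l := g)) + T (f(l := h))) \<and>
     (\<forall>f c. (\<forall>m. test_bound (m \<in> S) (c m) (f m)) \<longrightarrow> \<bar>T f\<bar> \<le> K * (\<Prod>m\<in>UNIV. c m)) \<and>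
     (\<forall>f g G. \<forall>l\<in>S. (\<forall>m. test_fun (m \<in> S) (f m)) \<longrightarrow>
        (\<forall>j. g j \<in> borel_measurable borel) \<longrightarrow> G \<in> borel_measurable borel \<longrightarrow>
        (\<forall>t\<in>{0..1}. \<forall>N. (\<Sum>j<N. \<bar>g j t\<bar>) \<le> 1) \<longrightarrow> (\<forall>t\<in>{0..1}. (\<lambda>j. g j t) sums G t) \<longrightarrow>
        (\<lambda>j::nat. T (f(l := g j))) sums T (f(l := G))) \<and>
     (\<forall>k. T (\<lambda>l t. t ^ k l) = \<mu> k)"

lemma moment_extension_lin:
  "moment_extension S K \<mu> T \<Longrightarrow> (\<And>m. test_fun (m \<in> S) (f m)) \<Longrightarrow> test_fun (l \<in> S) g \<Longrightarrow> test_fun (l \<in> S) h \<Longrightarrow>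
    T (f(l := \<lambda>t. a * g t + h t)) = a * T (f(l := g)) + T (f(l := h))"
  unfolding moment_extension_def by blast

lemma moment_extension_bound:
  "moment_extension S K \<mu> T \<Longrightarrow> (\<And>m. test_bound (m \<in> S) (c m) (f m)) \<Longrightarrow> \<bar>T f\<bar> \<le> K * (\<Prod>m\<in>UNIV. c m)"
  unfolding moment_extension_def by blast

lemma moment_extension_sums:
  "moment_extension S K \<mu> T \<Longrightarrow> l \<in> S \<Longrightarrow> (\<And>m. test_fun (m \<in> S) (f m)) \<Longrightarrow>
    (\<And>j. g j \<in> borel_measurable borel) \<Longrightarrow> G \<in> borel_measurable borel \<Longrightarrow>
    (\<And>t N. t \<in> {0..1} \<Longrightarrow> (\<Sum>j<N. \<bar>g j t\<bar>) \<le> 1) \<Longrightarrow> (\<And>t. t \<in> {0..1} \<Longrightarrow> (\<lambda>j. g j t) sums G t) \<Longrightarrow>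
    (\<lambda>j::nat. T (f(l := g j))) sums T (f(l := G))"
  unfolding moment_extension_def by blast

lemma moment_extension_moments: "moment_extension S K \<mu> T \<Longrightarrow> T (\<lambda>l t. t ^ k l) = \<mu> k"
  unfolding moment_extension_def by blast

lemma test_bound_imp_fun:
  assumes "test_bound b c f" shows "test_fun b f"
proof (cases b)
  case False
  then obtain k a where "f = (\<lambda>t. \<Sum>m\<le>k. a m * poly (bernstein_poly k m) t)"
    using assms by (auto simp: test_bound_def)
  then have "f = poly (\<Sum>m\<le>k. smult (a m) (bernstein_poly k m))"
    by (simp add: poly_sum fun_eq_iff)
  then show ?thesis using False by (auto simp: test_fun_def)
qed (use assms in \<open>auto simp: test_bound_def test_fun_def\<close>)

lemma test_fun_imp_bound:
  assumes "test_fun b f" shows "\<exists>c>0. test_bound b c f"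
proof (cases b)
  case True
  then show ?thesis using assms by (auto simp: test_bound_def test_fun_def bounded_borel_def)
next
  case False
  then obtain p where f: "f = poly p" using assms by (auto simp: test_fun_def)
  define k where "k = degree p"
  \<comment> \<open>Bernstein coefficients of \<open>p\<close>, found by expanding each monomial;
    they are 0 beyond \<open>k\<close> because \<open>test_bound\<close> demands a bound for every
    \<open>m\<close>.\<close>
  define a where "a m = (if m \<le> k then \<Sum>i\<le>k. coeff p i * (real (m choose i) / real (k choose i)) else 0)" for m
  have "f t = (\<Sum>m\<le>k. a m * poly (bernstein_poly k m) t)" for t
  proof -
    have "f t = (\<Sum>i\<le>k. coeff p i * t ^ i)" by (simp add: f k_def poly_altdef)
    also have "\<dots> = (\<Sum>i\<le>k. coeff p i *
        (\<Sum>m\<le>k. real (m choose i) / real (k choose i) * poly (bernstein_poly k m) t))"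
      by (intro sum.cong refl) (simp only: monom_eq_bernstein_sum atMost_iff)
    also have "\<dots> = (\<Sum>i\<le>k. \<Sum>m\<le>k. coeff p i *
        (real (m choose i) / real (k choose i)) * poly (bernstein_poly k m) t)"
      by (simp add: sum_distrib_left mult.assoc)
    also have "\<dots> = (\<Sum>m\<le>k. \<Sum>i\<le>k. coeff p i *
        (real (m choose i) / real (k choose i)) * poly (bernstein_poly k m) t)"
      by (rule sum.swap)
    also have "\<dots> = (\<Sum>m\<le>k. a m * poly (bernstein_poly k m) t)"
      by (intro sum.cong refl) (simp add: a_def sum_distrib_right)
    finally show ?thesis .
  qed
  moreover have "\<bar>a m\<bar> \<le> 1 + (\<Sum>m\<le>k. \<bar>a m\<bar>)" for m
  proof (cases "m \<le> k")
    case True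
    then have "\<bar>a m\<bar> \<le> (\<Sum>m\<le>k. \<bar>a m\<bar>)" by (intro member_le_sum) auto
    then show ?thesis by simp
  qed (simp add: a_def sum_nonneg add_nonneg_nonneg)
  moreover have "0 < 1 + (\<Sum>m\<le>k. \<bar>a m\<bar>)" by (simp add: sum_nonneg add_pos_nonneg)
  ultimately show ?thesis using False
    unfolding test_bound_def by (intro exI[of _ "1 + (\<Sum>m\<le>k. \<bar>a m\<bar>)"]) auto
qed

text \<open>Coordinate \<open>i\<close> is exempt: it is the variable about to be extended, and its
  entry in \<open>f\<close> gets overwritten.\<close>

lemma test_fun_choose_bounds:
  assumes "\<And>m. m \<noteq> i \<Longrightarrow> test_fun (m \<in> S) (f m)"
  shows "\<exists>c. \<forall>m. m \<noteq> i \<longrightarrow> 0 < c m \<and> test_bound (m \<in> S) (c m) (f m)"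
proof (rule choice, rule allI)
  fix m
  show "\<exists>c. m \<noteq> i \<longrightarrow> 0 < c \<and> test_bound (m \<in> S) c (f m)"
    using assms[of m] test_fun_imp_bound by blast
qed

lemma test_fun_lin: "test_fun b g \<Longrightarrow> test_fun b h \<Longrightarrow> test_fun b (\<lambda>t. a * g t + h t)"
proof (cases b)
  case False
  assume "test_fun b g" "test_fun b h"
  then obtain p q where "g = poly p" "h = poly q" using False by (auto simp: test_fun_def)
  then have "(\<lambda>t. a * g t + h t) = poly (smult a p + q)" by auto
  then show ?thesis using False by (simp add: test_fun_def)
qed (auto simp: test_fun_def intro: bounded_borel_lin)

lemma test_fun_const: "test_fun b (\<lambda>t. x)"
proof -
  have "(\<lambda>t. x) = poly [:x:]" by auto
  moreover have "bounded_borel (\<bar>x\<bar> + 1) (\<lambda>t. x)" by (rule bounded_borel_const) auto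
  ultimately show ?thesis by (auto simp: test_fun_def)
qed

lemma test_fun_sum:
  "finite F \<Longrightarrow> (\<And>j. j \<in> F \<Longrightarrow> test_fun b (g j)) \<Longrightarrow> test_fun b (\<lambda>t. \<Sum>j\<in>F. a j * g j t)"
  by (induction F rule: finite_induct) (auto simp: test_fun_const intro: test_fun_lin)

lemma moment_extension_sum:
  assumes T: "moment_extension S K \<mu> T" and f: "\<And>m. test_fun (m \<in> S) (f m)"
    and "finite F" and g: "\<And>j. j \<in> F \<Longrightarrow> test_fun (l \<in> S) (g j)"
  shows "T (f(l := \<lambda>t. \<Sum>j\<in>F. a j * g j t)) = (\<Sum>j\<in>F. a j * T (f(l := g j)))"
  using assms(3,4)
proof (induction F rule: finite_induct)
  case empty
  show ?case
    using moment_extension_lin[OF T f test_fun_const test_fun_const, of _ 1 0 0]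
    by (simp del: fun_upd_apply)
next
  case (insert x F)
  have "test_fun (l \<in> S) (\<lambda>t. \<Sum>j\<in>F. a j * g j t)" using insert by (intro test_fun_sum) auto
  from moment_extension_lin[OF T f _ this, of "g x" "a x"] insert show ?case
    by (simp del: fun_upd_apply)
qed

lemma moment_extension_expand:
  fixes J :: "'n::finite \<Rightarrow> 'j set"
  assumes T: "moment_extension S K \<mu> T" and "\<And>l. finite (J l)"
    and g: "\<And>l j. j \<in> J l \<Longrightarrow> test_fun (l \<in> S) (g l j)"
  shows "T (\<lambda>l t. \<Sum>j\<in>J l. a l j * g l j t) =
    (\<Sum>k\<in>PiE UNIV J. (\<Prod>l\<in>UNIV. a l (k l)) * T (\<lambda>l. g l (k l)))"
proof (rule multilinear_expand[where X = "\<lambda>l. Collect (test_fun (l \<in> S))"])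
  fix x :: "'n \<Rightarrow> real \<Rightarrow> real" and l assume "\<And>m. x m \<in> Collect (test_fun (m \<in> S))"
  then show "T (x(l := \<lambda>t. \<Sum>j\<in>J l. a l j * g l j t)) = (\<Sum>j\<in>J l. a l j * T (x(l := g l j)))"
    using assms by (intro moment_extension_sum[OF T]) auto
qed (use assms in \<open>auto intro: test_fun_sum\<close>)

lemma prod_fun_upd:
  fixes c :: "'n::finite \<Rightarrow> real"
  shows "(\<Prod>m\<in>UNIV. (c(i := x)) m) = x * (\<Prod>m\<in>UNIV - {i}. c m)"
  by (subst prod.remove[of _ i]) auto

text \<open>Start of the induction over the variables. Polynomial functions are read back as
  polynomials through the inverse of the injective \<open>poly\<close>, and division of the
  coefficients by \<open>c l\<close> reduces the bound to coefficients in the unit ball.\<close>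

lemma moment_extension_empty:
  fixes \<mu> :: "('n::finite \<Rightarrow> nat) \<Rightarrow> real"
  assumes bound: "\<And>k a. (\<And>l m. m \<le> k l \<Longrightarrow> \<bar>a l m\<bar> \<le> 1) \<Longrightarrow>
    \<bar>\<Sum>m\<in>PiE UNIV (\<lambda>l. {..k l}). (\<Prod>l\<in>UNIV. a l (m l)) * bernstein_coeff \<mu> k m\<bar> \<le> C"
  shows "moment_extension {} C \<mu> (\<lambda>f. moment_functional \<mu> (\<lambda>l. inv poly (f l)))"
    (is "moment_extension _ _ _ ?T")
proof -
  have inj: "inj (poly :: real poly \<Rightarrow> _)"
    by (auto simp: inj_def poly_eq_poly_eq_iff)
  have inv: "inv poly (poly p) = p" for p :: "real poly"
    by (rule inv_f_f[OF inj])
  have lin: "?T (f(l := \<lambda>t. a * g t + h t)) = a * ?T (f(l := g)) + ?T (f(l := h))"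
    if gh: "test_fun (l \<in> {}) g" "test_fun (l \<in> {}) h" for f l a g h
  proof -
    obtain p q where pq: "g = poly p" "h = poly q" using gh by (auto simp: test_fun_def)
    have eq: "(\<lambda>t. a * g t + h t) = poly (smult a p + q)" by (auto simp: pq)
    have upd: "(\<lambda>m. inv poly ((f(l := poly r)) m)) = (\<lambda>m. inv poly (f m))(l := r)" for r :: "real poly"
      by (auto simp: inv)
    show ?thesis unfolding eq unfolding pq upd by (rule moment_functional_linear)
  qed
  have bd: "\<bar>?T f\<bar> \<le> C * (\<Prod>l\<in>UNIV. c l)" if "\<And>l. test_bound (l \<in> {}) (c l) (f l)" for f c
  proof -
    have "\<forall>l. \<exists>k a. 0 < c l \<and> (\<forall>m. \<bar>a m\<bar> \<le> c l) \<and> f l = (\<lambda>t. \<Sum>m\<le>k. a m * poly (bernstein_poly k m) t)"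
      using that by (simp add: test_bound_def)
    then obtain k a where c: "\<And>l. 0 < c l" and a: "\<And>l m. \<bar>a l m\<bar> \<le> c l"
      and f: "\<And>l. f l = (\<lambda>t. \<Sum>m\<le>k l. a l m * poly (bernstein_poly (k l) m) t)"
      by metis
    have inv_f: "inv poly (f l) = (\<Sum>m\<le>k l. smult (a l m) (bernstein_poly (k l) m))" for l
    proof -
      have "f l = poly (\<Sum>m\<le>k l. smult (a l m) (bernstein_poly (k l) m))"
        by (simp add: f poly_sum fun_eq_iff)
      then show ?thesis by (simp add: inv)
    qed
    have expand: "?T f = (\<Sum>m\<in>PiE UNIV (\<lambda>l. {..k l}). (\<Prod>l\<in>UNIV. a l (m l)) * bernstein_coeff \<mu> k m)"
      unfolding bernstein_coeff_def inv_f
    proof (rule multilinear_expand[where X = "\<lambda>_. UNIV"])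
      fix x :: "'n \<Rightarrow> real poly" and l
      show "moment_functional \<mu> (x(l := \<Sum>m\<le>k l. smult (a l m) (bernstein_poly (k l) m))) =
          (\<Sum>m\<le>k l. a l m * moment_functional \<mu> (x(l := bernstein_poly (k l) m)))"
        by (rule poly_functional_sum[where L = "\<lambda>p. moment_functional \<mu> (x(l := p))"])
          (simp_all add: moment_functional_linear del: fun_upd_apply)
    qed auto
    have "\<bar>a l m / c l\<bar> \<le> 1" for l m
      using a[of l m] c[of l] by (simp add: abs_divide abs_of_pos divide_le_eq_1)
    then have "\<bar>\<Sum>m\<in>PiE UNIV (\<lambda>l. {..k l}). (\<Prod>l\<in>UNIV. a l (m l) / c l) * bernstein_coeff \<mu> k m\<bar> \<le> C"
      by (rule bound)
    moreover have "(\<Sum>m\<in>PiE UNIV (\<lambda>l. {..k l}). (\<Prod>l\<in>UNIV. a l (m l) / c l) * bernstein_coeff \<mu> k m) =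
        ?T f / (\<Prod>l\<in>UNIV. c l)"
      unfolding expand by (simp add: prod_dividef sum_divide_distrib)
    moreover have "0 < (\<Prod>l\<in>UNIV. c l)" using c by (intro prod_pos) auto
    ultimately show ?thesis by (simp add: abs_divide divide_le_eq)
  qed
  have mom: "?T (\<lambda>l t. t ^ k l) = \<mu> k" for k
  proof -
    have "(\<lambda>t :: real. t ^ j) = poly (monom 1 j)" for j :: nat by (auto simp: poly_monom)
    then show ?thesis by (simp add: inv moment_functional_monom)
  qed
  show ?thesis
    unfolding moment_extension_def using lin bd mom by blast
qed

text \<open>\<open>E f\<close> extends the functional \<open>L f\<close> on polynomials in variable
  \<open>i\<close>, and \<open>T' f\<close> evaluates it at the entry \<open>f i\<close>. Linearity
  in the other variables and the bound follow from uniqueness of the extension, \<sigma>-additivity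
  in the variables of \<open>S\<close> from \<open>bilinear_functional_sums\<close>.\<close>

lemma moment_extension_insert:
  fixes \<mu> :: "('n::finite \<Rightarrow> nat) \<Rightarrow> real"
  assumes T: "moment_extension S K \<mu> T" and K: "0 < K" and i: "i \<notin> S"
  shows "\<exists>T'. moment_extension (insert i S) (3 * K) \<mu> T'"
proof -
  define L where "L f p = T (f(i := poly p))" for f p
  \<comment> \<open>The choice asks only for some bound \<open>M\<close>, so \<open>E f\<close> does
    not depend on bounds selected for the entries of \<open>f\<close>. If these are not test
    functions, its value may be arbitrary.\<close>
  define E where "E f = (SOME \<Phi>. (\<exists>M. borel_functional M \<Phi>) \<and> (\<forall>p. \<Phi> (poly p) = L f p))" for f
  have poly_test: "test_fun (i \<in> S) (poly p)" for p using i by (simp add: test_fun_def)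
  have L_lin: "L f (smult a p + q) = a * L f p + L f q" if f: "\<And>m. m \<noteq> i \<Longrightarrow> test_fun (m \<in> S) (f m)" for f a p q
  proof -
    have "\<And>m. test_fun (m \<in> S) ((f(i := poly 0)) m)" using f poly_test[of 0] by auto
    from moment_extension_lin[OF T this poly_test[of p] poly_test[of q], of a] show ?thesis
      by (simp add: L_def poly_add[abs_def] poly_smult[abs_def] del: fun_upd_apply)
  qed
  have ext: "\<exists>\<Phi>. borel_functional (3 * (K * (\<Prod>m\<in>UNIV - {i}. c m))) \<Phi> \<and> (\<forall>p. \<Phi> (poly p) = L f p)"
    if f: "\<And>m. m \<noteq> i \<Longrightarrow> 0 < c m \<and> test_bound (m \<in> S) (c m) (f m)" for f c
  proof (rule borel_functional_extension)
    have tf: "\<And>m. m \<noteq> i \<Longrightarrow> test_fun (m \<in> S) (f m)" using f test_bound_imp_fun by blast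
    show "L f (smult a p + q) = a * L f p + L f q" for a p q by (rule L_lin[OF tf])
    fix k and a :: "nat \<Rightarrow> real" assume a: "\<And>m. \<bar>a m\<bar> \<le> 1"
    have "(\<Sum>m\<le>k. a m * L f (bernstein_poly k m)) = L f (\<Sum>m\<le>k. smult (a m) (bernstein_poly k m))"
      by (rule poly_functional_sum[symmetric]) (simp_all add: L_lin[OF tf])
    also have "\<dots> = T (f(i := \<lambda>t. \<Sum>m\<le>k. a m * poly (bernstein_poly k m) t))"
      by (simp add: L_def poly_sum[abs_def])
    also have "\<bar>\<dots>\<bar> \<le> K * (\<Prod>m\<in>UNIV. (c(i := 1)) m)"
      by (rule moment_extension_bound[OF T]) (use f i a in \<open>auto simp: test_bound_def\<close>)
    finally show "\<bar>\<Sum>m\<le>k. a m * L f (bernstein_poly k m)\<bar> \<le> K * (\<Prod>m\<in>UNIV - {i}. c m)"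
      by (simp only: prod_fun_upd mult_1)
  next
    show "0 < K * (\<Prod>m\<in>UNIV - {i}. c m)" using f K by (intro mult_pos_pos prod_pos) auto
  qed
  have E: "\<exists>M. borel_functional M (E f)" "E f (poly p) = L f p"
    if f: "\<And>m. m \<noteq> i \<Longrightarrow> test_fun (m \<in> S) (f m)" for f p
  proof -
    have "\<exists>c. \<forall>m. m \<noteq> i \<longrightarrow> 0 < c m \<and> test_bound (m \<in> S) (c m) (f m)"
      by (rule test_fun_choose_bounds[OF f])
    then have "\<exists>\<Phi>. (\<exists>M. borel_functional M \<Phi>) \<and> (\<forall>p. \<Phi> (poly p) = L f p)"
      using ext by blast
    from someI_ex[OF this] show "\<exists>M. borel_functional M (E f)" "E f (poly p) = L f p"
      unfolding E_def by blast+
  qed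
  \<comment> \<open>Every choice of bounds \<open>c\<close> produces an extension with the
    corresponding constant; by uniqueness it coincides with \<open>E f\<close> on bounded Borel
    functions, which thereby inherits the constant.\<close>
  have E_fun: "borel_functional (3 * (K * (\<Prod>m\<in>UNIV - {i}. c m))) (E f)"
    if f: "\<And>m. m \<noteq> i \<Longrightarrow> 0 < c m \<and> test_bound (m \<in> S) (c m) (f m)" for f c
  proof -
    have tf: "\<And>m. m \<noteq> i \<Longrightarrow> test_fun (m \<in> S) (f m)" using f test_bound_imp_fun by blast
    obtain \<Phi> where \<Phi>: "borel_functional (3 * (K * (\<Prod>m\<in>UNIV - {i}. c m))) \<Phi>" "\<And>p. \<Phi> (poly p) = L f p"
      using ext[OF f] by blast
    obtain M where M: "borel_functional M (E f)" using E[OF tf] by blast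
    have eq: "E f g = \<Phi> g" if "bounded_borel d g" for d g
      by (rule borel_functional_eqI[OF M \<Phi>(1) _ that]) (simp add: E(2)[OF tf] \<Phi>(2))
    have "\<bar>E f g\<bar> \<le> 3 * (K * (\<Prod>m\<in>UNIV - {i}. c m)) * d" if "bounded_borel d g" for d g
      using borel_functional_bound[OF \<Phi>(1) that] eq[OF that] by simp
    then show ?thesis using M unfolding borel_functional_def by blast
  qed
  \<comment> \<open>\<open>L\<close> overwrites the entry at \<open>i\<close>, so an update there
    changes only the argument at which \<open>T'\<close> evaluates \<open>E f\<close>.\<close>
  have E_upd: "E (f(i := g)) = E f" for f g
    unfolding E_def L_def by simp
  define T' where "T' f = E f (f i)" for f
  have upd_i: "T' (f(i := g)) = E f g" for f g
    by (simp add: T'_def E_upd)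
  have E_lin: "E (f(l := \<lambda>t. a * g t + h t)) x = a * E (f(l := g)) x + E (f(l := h)) x"
    if f: "\<And>m. m \<noteq> i \<Longrightarrow> test_fun (m \<in> S) (f m)" and l: "l \<noteq> i"
      and g: "test_fun (l \<in> S) g" and h: "test_fun (l \<in> S) h" and x: "bounded_borel d x" for f l a g h x d
  proof -
    have upd: "\<And>m. m \<noteq> i \<Longrightarrow> test_fun (m \<in> S) ((f(l := y)) m)" if "test_fun (l \<in> S) y" for y
      using that f by auto
    have E_upd_test: "\<exists>M. borel_functional M (E (f(l := y)))" "E (f(l := y)) (poly p) = L (f(l := y)) p"
      if "test_fun (l \<in> S) y" for y p
      by (rule E, rule upd, rule that, assumption)+
    obtain M1 M2 M3 where M: "borel_functional M1 (E (f(l := \<lambda>t. a * g t + h t)))"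
      "borel_functional M2 (E (f(l := g)))" "borel_functional M3 (E (f(l := h)))"
      using E_upd_test(1)[OF g] E_upd_test(1)[OF h] E_upd_test(1)[OF test_fun_lin[OF g h]] by blast
    show ?thesis
    proof (rule borel_functional_eqI[OF M(1) borel_functional_lin_comb[OF M(2,3)] _ x])
      fix p
      have f': "\<And>m. test_fun (m \<in> S) ((f(i := poly p)) m)" using f poly_test by auto
      show "E (f(l := \<lambda>t. a * g t + h t)) (poly p) = a * E (f(l := g)) (poly p) + E (f(l := h)) (poly p)"
        using moment_extension_lin[OF T f' g h, of a] l
        by (simp add: E_upd_test(2) g h test_fun_lin L_def fun_upd_twist[of l i] del: fun_upd_apply)
    qed
  qed
  have dom: "test_fun (m \<in> insert i S) g \<longleftrightarrow> test_fun (m \<in> S) g" if "m \<noteq> i" for m g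
    using that by simp
  show ?thesis
  proof (intro exI[of _ T'], unfold moment_extension_def, intro conjI allI impI ballI)
    fix f l a g h
    assume f: "\<forall>m. test_fun (m \<in> insert i S) (f m)" and g: "test_fun (l \<in> insert i S) g"
      and h: "test_fun (l \<in> insert i S) h"
    have f': "test_fun (m \<in> S) (f m)" if "m \<noteq> i" for m
      using f[rule_format, of m] that by simp
    show "T' (f(l := \<lambda>t. a * g t + h t)) = a * T' (f(l := g)) + T' (f(l := h))"
    proof (cases "l = i")
      case True
      obtain M where "borel_functional M (E f)" using E(1)[OF f'] by blast
      moreover obtain c d where "bounded_borel c g" "bounded_borel d h"
        using g h True by (auto simp: test_fun_def)
      ultimately show ?thesis unfolding True upd_i by (rule borel_functional_lin)
    next
      case False
      obtain d where "bounded_borel d (f i)" using f[rule_format, of i] by (auto simp: test_fun_def)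
      from E_lin[OF f' False _ _ this] show ?thesis
        using g h False by (simp add: T'_def)
    qed
  next
    fix f c assume f: "\<forall>m. test_bound (m \<in> insert i S) (c m) (f m)"
    have "0 < c m" for m
      using f[rule_format, of m] by (auto simp: test_bound_def bounded_borel_def split: if_splits)
    moreover have "test_bound (m \<in> S) (c m) (f m)" if "m \<noteq> i" for m
      using f[rule_format, of m] that by simp
    ultimately have "borel_functional (3 * (K * (\<Prod>m\<in>UNIV - {i}. c m))) (E f)" by (intro E_fun) auto
    moreover have "bounded_borel (c i) (f i)" using f[rule_format, of i] by (simp add: test_bound_def)
    ultimately have "\<bar>T' f\<bar> \<le> 3 * (K * (\<Prod>m\<in>UNIV - {i}. c m)) * c i"
      unfolding T'_def by (rule borel_functional_bound)
    then show "\<bar>T' f\<bar> \<le> 3 * K * (\<Prod>m\<in>UNIV. c m)"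
      by (subst prod.remove[of _ i]) (simp_all add: algebra_simps)
  next
    fix f l and g :: "nat \<Rightarrow> real \<Rightarrow> real" and G
    assume l: "l \<in> insert i S" and f: "\<forall>m. test_fun (m \<in> insert i S) (f m)"
      and g: "\<forall>j. g j \<in> borel_measurable borel" "G \<in> borel_measurable borel"
        "\<forall>t\<in>{0..1}. \<forall>N. (\<Sum>j<N. \<bar>g j t\<bar>) \<le> 1" "\<forall>t\<in>{0..1}. (\<lambda>j. g j t) sums G t"
    have f': "test_fun (m \<in> S) (f m)" if "m \<noteq> i" for m
      using f[rule_format, of m] that by simp
    show "(\<lambda>j. T' (f(l := g j))) sums T' (f(l := G))"
    proof (cases "l = i")
      case True
      obtain M where M: "borel_functional M (E f)" using E(1)[OF f'] by blast
      show ?thesis unfolding True upd_i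
        by (rule borel_functional_sums[OF M]) (use g in auto)
    next
      case False
      then have l: "l \<in> S" using l by simp
      obtain e where e: "bounded_borel e (f i)" using f[rule_format, of i] by (auto simp: test_fun_def)
      have "\<exists>c. \<forall>m. m \<noteq> i \<longrightarrow> 0 < c m \<and> test_bound (m \<in> S) (c m) (f m)"
        by (rule test_fun_choose_bounds[OF f'])
      then obtain c where c: "\<And>m. m \<noteq> i \<Longrightarrow> 0 < c m \<and> test_bound (m \<in> S) (c m) (f m)" by blast
      \<comment> \<open>A bilinear form in the entries at \<open>l\<close> and \<open>i\<close>; the
        bounds of the other, fixed entries go into its constant.\<close>
      have "(\<lambda>j. E (f(l := g j)) (f i)) sums E (f(l := G)) (f i)"
      proof (rule bilinear_functional_sums[where \<Psi> = "\<lambda>g. E (f(l := g))"])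
        show "E (f(l := \<lambda>t. a * u t + v t)) x = a * E (f(l := u)) x + E (f(l := v)) x"
          if "bounded_borel b u" "bounded_borel d v" "bounded_borel e x" for a b d e u v x
          using that l by (intro E_lin[OF f' False]) (auto simp: test_fun_def)
        show "borel_functional (3 * K * (\<Prod>m\<in>UNIV - {i} - {l}. c m) * d) (E (f(l := u)))"
          if u: "bounded_borel d u" for d u
        proof -
          have "0 < d \<and> test_bound (l \<in> S) d u"
            using u l by (simp add: test_bound_def bounded_borel_def)
          then have "borel_functional (3 * (K * (\<Prod>m\<in>UNIV - {i}. (c(l := d)) m))) (E (f(l := u)))"
            using c by (intro E_fun) auto
          also have "(\<Prod>m\<in>UNIV - {i}. (c(l := d)) m) = d * (\<Prod>m\<in>UNIV - {i} - {l}. c m)"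
            using False by (subst prod.remove[of _ l]) auto
          finally show ?thesis by (simp add: algebra_simps del: fun_upd_apply)
        qed
        show "(\<lambda>j. E (f(l := g j)) (poly p)) sums E (f(l := G)) (poly p)" for p
        proof -
          have eq: "E (f(l := u)) (poly p) = T ((f(i := poly p))(l := u))" if "bounded_borel 1 u" for u
            using f' False l that by (subst E(2)) (auto simp: L_def fun_upd_twist test_fun_def)
          have f'': "\<And>m. test_fun (m \<in> S) ((f(i := poly p)) m)" using f' poly_test by auto
          have "(\<lambda>j. T ((f(i := poly p))(l := g j))) sums T ((f(i := poly p))(l := G))"
            by (rule moment_extension_sums[OF T l f'']) (use g in auto)
          moreover have "E (f(l := g j)) (poly p) = T ((f(i := poly p))(l := g j))" for j
            by (rule eq, rule bounded_borel_summand) (use g in auto)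
          moreover have "E (f(l := G)) (poly p) = T ((f(i := poly p))(l := G))"
            by (rule eq, rule bounded_borel_sums[OF g(2), of g]) (use g in auto)
          ultimately show ?thesis by (simp only:)
        qed
      qed (use g e in auto)
      then show ?thesis using False by (simp add: T'_def)
    qed
  next
    fix k
    have tf: "test_fun b (\<lambda>t. t ^ j)" for b j
    proof -
      have "(\<lambda>t :: real. t ^ j) = poly (monom 1 j)" by (auto simp: poly_monom)
      then show ?thesis using bounded_borel_poly[of "monom 1 j"] by (auto simp: test_fun_def)
    qed
    have p: "(\<lambda>t :: real. t ^ k i) = poly (monom 1 (k i))" by (auto simp: poly_monom)
    have "T' (\<lambda>l t. t ^ k l) = E (\<lambda>l t. t ^ k l) (poly (monom 1 (k i)))"
      by (simp add: T'_def p)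
    also have "\<dots> = T ((\<lambda>l t. t ^ k l)(i := poly (monom 1 (k i))))"
      by (subst E(2)) (auto simp: tf L_def)
    also have "(\<lambda>l t :: real. t ^ k l)(i := poly (monom 1 (k i))) = (\<lambda>l t. t ^ k l)"
      by (auto simp flip: p)
    finally show "T' (\<lambda>l t. t ^ k l) = \<mu> k" by (simp add: moment_extension_moments[OF T])
  qed
qed

text \<open>Every inserted variable multiplies the constant by 3, so \<open>K\<close> is
  \<open>C\<close> times a power of 3.\<close>

lemma moment_extension_exists:
  fixes \<mu> :: "('n::finite \<Rightarrow> nat) \<Rightarrow> real"
  assumes "weakly_bounded TYPE(real) \<mu>"
  shows "\<exists>K T. 0 < K \<and> moment_extension UNIV K \<mu> T"
proof -
  obtain C where C: "0 < C"
    and bound: "\<And>k a. (\<And>l m. m \<le> k l \<Longrightarrow> \<bar>a l m\<bar> \<le> 1) \<Longrightarrow>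
      \<bar>\<Sum>m\<in>PiE UNIV (\<lambda>l. {..k l}). (\<Prod>l\<in>UNIV. a l (m l)) * bernstein_coeff \<mu> k m\<bar> \<le> C"
    using assms unfolding weakly_bounded_def by auto
  have "\<exists>K T. 0 < K \<and> moment_extension S K \<mu> T" if "finite S" for S :: "'n set"
    using that
  proof (induction S rule: finite_induct)
    case empty
    show ?case using C moment_extension_empty[OF bound] by blast
  next
    case (insert i S)
    then obtain K T where K: "0 < K" "moment_extension S K \<mu> T" by blast
    obtain T' where "moment_extension (insert i S) (3 * K) \<mu> T'"
      using moment_extension_insert[OF K(2,1) insert(2)] by blast
    then show ?case using K(1) by (intro exI[of _ "3 * K"] exI[of _ T']) simp
  qed
  then show ?thesis by simp
qed

subsection \<open>Solvability implies weak boundedness\<close>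

lemma sets_Bo_I: "A \<in> sets Bo_I \<longleftrightarrow> A \<in> sets borel \<and> A \<subseteq> {0..1}"
  by (auto simp: sets_restrict_space_iff)

lemma space_Bo_I: "space Bo_I = {0..1}"
  by (simp add: space_restrict_space)

section \<open>Step functions on a uniform grid\<close>

definition grid :: "nat \<Rightarrow> real \<Rightarrow> real" where
  "grid N t = of_int \<lfloor>real N * t\<rfloor> / real N"

text \<open>For \<open>0 < N\<close> there are \<open>N + 1\<close> nonempty cells, with
  \<open>i\<close> from 0 to \<open>N\<close>: the half-open intervals of length
  \<open>1 / N\<close> and, as the last cell, the singleton \<open>{1}\<close>.\<close>

definition cell :: "nat \<Rightarrow> nat \<Rightarrow> real set" where
  "cell N i = {t \<in> {0..1}. \<lfloor>real N * t\<rfloor> = int i}"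

lemma grid_approx:
  assumes "t \<in> {0..1}" "0 < N"
  shows "grid N t \<in> {0..1}" "\<bar>grid N t - t\<bar> \<le> 1 / real N"
proof -
  have le: "of_int \<lfloor>real N * t\<rfloor> \<le> real N * t" "real N * t \<le> of_int \<lfloor>real N * t\<rfloor> + 1"
    by linarith+
  have "real N * t \<le> real N * 1" using assms by (intro mult_left_mono) auto
  then have "of_int \<lfloor>real N * t\<rfloor> \<le> real N" using le by linarith
  moreover have "(0 :: real) \<le> of_int \<lfloor>real N * t\<rfloor>" using assms by simp
  ultimately show "grid N t \<in> {0..1}" using assms by (simp add: grid_def divide_le_eq)
  have "grid N t - t = (of_int \<lfloor>real N * t\<rfloor> - real N * t) / real N"
    using assms by (simp add: grid_def field_simps)
  moreover have "\<bar>of_int \<lfloor>real N * t\<rfloor> - real N * t\<bar> \<le> 1" using le by linarith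
  ultimately show "\<bar>grid N t - t\<bar> \<le> 1 / real N"
    by (simp only: abs_divide abs_of_nat divide_right_mono of_nat_0_le_iff)
qed

lemma simple_function_grid: "simple_function Bo_I (grid N)"
proof (rule simple_function_borel_measurable)
  show "grid N \<in> borel_measurable Bo_I"
    unfolding grid_def by (intro measurable_restrict_space1) measurable
  have "grid N ` space Bo_I \<subseteq> (\<lambda>i. of_int i / real N) ` {0..int N}"
  proof
    fix x assume "x \<in> grid N ` space Bo_I"
    then obtain t where t: "t \<in> {0..1}" "x = grid N t" by (auto simp: space_Bo_I)
    have "real N * t \<le> real N * 1" using t by (intro mult_left_mono) auto
    then have "\<lfloor>real N * t\<rfloor> \<in> {0..int N}" using t by (simp add: floor_le_iff)
    then show "x \<in> (\<lambda>i. of_int i / real N) ` {0..int N}" using t(2) unfolding grid_def by blast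
  qed
  then show "finite (grid N ` space Bo_I)" by (rule finite_subset) simp
qed

text \<open>On the unit interval a power is Lipschitz with its exponent as constant.
  \<open>Suc j\<close> keeps the number of grid steps positive.\<close>

lemma uniform_simple_approx_grid:
  "uniform_simple_approx (\<lambda>_. Bo_I) (\<lambda>j l t. of_real (grid (Suc j) t ^ k l) :: 'a::real_normed_field)
    (\<lambda>l t. of_real (t ^ k l))"
  unfolding uniform_simple_approx_def
proof (intro conjI allI)
  fix j l
  show "simple_function Bo_I (\<lambda>t. of_real (grid (Suc j) t ^ k l) :: 'a)"
    by (rule simple_function_compose1[OF simple_function_grid])
next
  fix l
  show "uniform_limit (space Bo_I) (\<lambda>j t. of_real (grid (Suc j) t ^ k l) :: 'a) (\<lambda>t. of_real (t ^ k l)) sequentially"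
  proof (rule uniform_limitI)
    fix e :: real assume e: "0 < e"
    have "(\<lambda>j. real (k l) * (1 / real (Suc j))) \<longlonglongrightarrow> real (k l) * 0"
      by (intro tendsto_intros LIMSEQ_Suc lim_1_over_n)
    then have "\<forall>\<^sub>F j in sequentially. real (k l) * (1 / real (Suc j)) < e"
      using e by (intro order_tendstoD) auto
    then show "\<forall>\<^sub>F j in sequentially. \<forall>t\<in>space Bo_I. dist (of_real (grid (Suc j) t ^ k l) :: 'a) (of_real (t ^ k l)) < e"
    proof eventually_elim
      case (elim j)
      show ?case
      proof
        fix t assume "t \<in> space Bo_I"
        then have t: "t \<in> {0..1}" by (simp add: space_Bo_I)
        have "norm (grid (Suc j) t ^ k l - t ^ k l) \<le> real (k l) * norm (grid (Suc j) t - t)"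
          using grid_approx(1)[OF t, of "Suc j"] t by (intro norm_power_diff) auto
        also have "\<dots> \<le> real (k l) * (1 / real (Suc j))"
          using grid_approx(2)[OF t, of "Suc j"] by (intro mult_left_mono) auto
        finally show "dist (of_real (grid (Suc j) t ^ k l) :: 'a) (of_real (t ^ k l)) < e"
          using elim by (simp add: dist_norm flip: of_real_power of_real_diff)
      qed
    qed
  qed
qed

lemma cell_partition:
  assumes "0 < N"
  shows "measurable_partition Bo_I (space Bo_I) (Suc N) (cell N)"
  unfolding measurable_partition_def
proof (intro conjI allI impI)
  fix j
  have "{t. \<lfloor>real N * t\<rfloor> = int j} \<in> sets borel" by measurable
  then have "{0..1} \<inter> {t. \<lfloor>real N * t\<rfloor> = int j} \<in> sets borel" by (intro sets.Int) auto
  moreover have "cell N j = {0..1} \<inter> {t. \<lfloor>real N * t\<rfloor> = int j}" by (auto simp: cell_def)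
  ultimately show "cell N j \<in> sets Bo_I" by (simp add: sets_Bo_I)
next
  show "disjoint_family_on (cell N) {..<Suc N}" by (auto simp: disjoint_family_on_def cell_def)
  show "(\<Union>j<Suc N. cell N j) = space Bo_I"
  proof
    show "space Bo_I \<subseteq> (\<Union>j<Suc N. cell N j)"
    proof
      fix t assume "t \<in> space Bo_I"
      then have t: "t \<in> {0..1}" by (simp add: space_Bo_I)
      have "real N * t \<le> real N * 1" using t by (intro mult_left_mono) auto
      then have "\<lfloor>real N * t\<rfloor> \<in> {0..int N}" using t by (simp add: floor_le_iff)
      then have "t \<in> cell N (nat \<lfloor>real N * t\<rfloor>)" "nat \<lfloor>real N * t\<rfloor> < Suc N"
        using t by (auto simp: cell_def)
      then show "t \<in> (\<Union>j<Suc N. cell N j)" by blast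
    qed
  qed (auto simp: cell_def space_Bo_I)
qed

lemma cell_nonempty:
  assumes "0 < N" "i < Suc N"
  shows "cell N i \<noteq> {}"
proof -
  have "real i / real N \<in> cell N i" using assms by (auto simp: cell_def divide_le_eq_1)
  then show ?thesis by blast
qed

lemma grid_cell: "t \<in> cell N i \<Longrightarrow> grid N t = real i / real N"
  by (simp add: cell_def grid_def)

section \<open>Finite additivity and integrals over partitions\<close>

lemma polymeasure_empty:
  assumes \<gamma>: "polymeasure M \<gamma>" and A: "\<And>i. A i \<in> sets (M i)"
  shows "\<gamma> (A(l := {})) = 0"
proof -
  have "(\<lambda>j::nat. \<gamma> (A(l := {}))) sums \<gamma> (A(l := (\<Union>j::nat. {})))"
    using \<gamma>[unfolded polymeasure_def, rule_format, of A "\<lambda>_. {}" l] A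
    by (auto simp: disjoint_family_on_def)
  \<comment> \<open>A constant series converges only if its terms vanish.\<close>
  then have "summable (\<lambda>j::nat. \<gamma> (A(l := {})))" by (rule sums_summable)
  then show ?thesis by (simp add: summable_const_iff)
qed

lemma polymeasure_finite_additive:
  assumes \<gamma>: "polymeasure M \<gamma>" and A: "\<And>i. A i \<in> sets (M i)"
    and I: "finite (I :: nat set)" and B: "\<And>i. i \<in> I \<Longrightarrow> B i \<in> sets (M l)"
    and disj: "disjoint_family_on B I"
  shows "\<gamma> (A(l := (\<Union>i\<in>I. B i))) = (\<Sum>i\<in>I. \<gamma> (A(l := B i)))"
proof -
  define B' where "B' j = (if j \<in> I then B j else {})" for j
  have "range B' \<subseteq> sets (M l)" using B by (auto simp: B'_def)
  moreover have "disjoint_family B'" using disj by (auto simp: disjoint_family_on_def B'_def)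
  ultimately have "(\<lambda>j. \<gamma> (A(l := B' j))) sums \<gamma> (A(l := (\<Union>j. B' j)))"
    using \<gamma> A unfolding polymeasure_def by blast
  moreover have "(\<Union>j. B' j) = (\<Union>i\<in>I. B i)" by (auto simp: B'_def split: if_splits)
  moreover have "(\<lambda>j. \<gamma> (A(l := B' j))) sums (\<Sum>j\<in>I. \<gamma> (A(l := B' j)))"
    using I polymeasure_empty[OF \<gamma> A] by (intro sums_finite) (auto simp: B'_def)
  moreover have "(\<Sum>j\<in>I. \<gamma> (A(l := B' j))) = (\<Sum>i\<in>I. \<gamma> (A(l := B i)))"
    by (intro sum.cong) (auto simp: B'_def)
  ultimately show ?thesis using sums_unique2 by metis
qed

text \<open>\<open>simple_polyintegral\<close> runs over values, whereas several cells may share a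
  value here. Each level set is the union of its cells, and finite additivity splits it in every
  argument. Nonemptiness of the cells ensures that each \<open>\<phi> l j\<close> is attained by
  \<open>f l\<close>.\<close>

lemma simple_polyintegral_partition:
  fixes M :: "'n::finite \<Rightarrow> 's measure" and \<gamma> :: "('n \<Rightarrow> 's set) \<Rightarrow> 'a::real_normed_field"
  assumes \<gamma>: "polymeasure M \<gamma>"
    and part: "\<And>l. measurable_partition (M l) (space (M l)) (r l) (E l)"
    and ne: "\<And>l j. j < r l \<Longrightarrow> E l j \<noteq> {}"
    and f: "\<And>l j t. j < r l \<Longrightarrow> t \<in> E l j \<Longrightarrow> f l t = \<phi> l j"
  shows "simple_polyintegral M \<gamma> f =
    (\<Sum>i\<in>PiE UNIV (\<lambda>l. {..<r l}). (\<Prod>l\<in>UNIV. \<phi> l (i l)) * \<gamma> (\<lambda>l. E l (i l)))"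
proof -
  have E_sets: "\<And>l j. j < r l \<Longrightarrow> E l j \<in> sets (M l)" and disj: "\<And>l. disjoint_family_on (E l) {..<r l}"
    and un: "\<And>l. (\<Union>j<r l. E l j) = space (M l)"
    using part by (auto simp: measurable_partition_def)
  define J where "J l z = {j. j < r l \<and> \<phi> l j = z}" for l z
  have img: "f l ` space (M l) = \<phi> l ` {..<r l}" for l
  proof (intro equalityI subsetI)
    fix y assume "y \<in> f l ` space (M l)"
    then obtain t where "t \<in> space (M l)" "y = f l t" by blast
    moreover then obtain j where "j < r l" "t \<in> E l j" using un[of l] by blast
    ultimately show "y \<in> \<phi> l ` {..<r l}" using f by auto
  next
    fix y assume "y \<in> \<phi> l ` {..<r l}"
    then obtain j where j: "j < r l" "y = \<phi> l j" by blast
    obtain t where "t \<in> E l j" using ne[OF j(1)] by blast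
    moreover have "t \<in> space (M l)" using un[of l] j \<open>t \<in> E l j\<close> by blast
    ultimately show "y \<in> f l ` space (M l)" using f[OF j(1)] j(2) by (intro image_eqI[of _ _ t]) auto
  qed
  have vimage: "f l -` {z} \<inter> space (M l) = (\<Union>j\<in>J l z. E l j)" for l z
    unfolding un[symmetric] using f by (auto simp: J_def)
  have expand: "\<gamma> (\<lambda>l. \<Union>j\<in>J l (y l). E l j) =
      (\<Sum>i\<in>PiE UNIV (\<lambda>l. J l (y l)). (\<Prod>l\<in>(UNIV :: 'n set). 1) * \<gamma> (\<lambda>l. E l (i l)))" for y
  proof (rule multilinear_expand[where X = "\<lambda>l. sets (M l)" and c = "\<lambda>_ _. 1" and G = \<gamma> and v = E
        and J = "\<lambda>l. J l (y l)" and u = "\<lambda>l. \<Union>j\<in>J l (y l). E l j"])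
    fix x l assume "\<And>m. x m \<in> sets (M m)"
    then have "\<gamma> (x(l := (\<Union>j\<in>J l (y l). E l j))) = (\<Sum>j\<in>J l (y l). \<gamma> (x(l := E l j)))"
      using E_sets by (intro polymeasure_finite_additive[OF \<gamma>])
        (auto simp: J_def intro: disjoint_family_on_mono[OF _ disj])
    then show "\<gamma> (x(l := (\<Union>j\<in>J l (y l). E l j))) = (\<Sum>j\<in>J l (y l). 1 * \<gamma> (x(l := E l j)))"
      by simp
  qed (use E_sets in \<open>auto simp: J_def\<close>)
  have "simple_polyintegral M \<gamma> f =
      (\<Sum>y\<in>PiE UNIV (\<lambda>l. \<phi> l ` {..<r l}). (\<Prod>l\<in>UNIV. y l) * \<gamma> (\<lambda>l. \<Union>j\<in>J l (y l). E l j))"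
    by (simp add: simple_polyintegral_def img vimage)
  \<comment> \<open>Index tuples are grouped by the tuple of values they produce.\<close>
  also have "\<dots> = (\<Sum>y\<in>PiE UNIV (\<lambda>l. \<phi> l ` {..<r l}). \<Sum>i\<in>{i \<in> PiE UNIV (\<lambda>l. {..<r l}). (\<lambda>l. \<phi> l (i l)) = y}.
      (\<Prod>l\<in>UNIV. \<phi> l (i l)) * \<gamma> (\<lambda>l. E l (i l)))"
  proof (intro sum.cong refl)
    fix y
    have "{i \<in> PiE UNIV (\<lambda>l. {..<r l}). (\<lambda>l. \<phi> l (i l)) = y} = PiE UNIV (\<lambda>l. J l (y l))"
      by (auto simp: J_def PiE_iff)
    then show "(\<Prod>l\<in>UNIV. y l) * \<gamma> (\<lambda>l. \<Union>j\<in>J l (y l). E l j) =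
        (\<Sum>i\<in>{i \<in> PiE UNIV (\<lambda>l. {..<r l}). (\<lambda>l. \<phi> l (i l)) = y}.
          (\<Prod>l\<in>UNIV. \<phi> l (i l)) * \<gamma> (\<lambda>l. E l (i l)))"
      unfolding expand by (auto simp: sum_distrib_left J_def PiE_iff intro!: sum.cong)
  qed
  also have "\<dots> = (\<Sum>i\<in>PiE UNIV (\<lambda>l. {..<r l}). (\<Prod>l\<in>UNIV. \<phi> l (i l)) * \<gamma> (\<lambda>l. E l (i l)))"
    by (rule sum.group) (auto intro!: finite_PiE)
  finally show ?thesis .
qed

lemma finite_semivariation_bound:
  fixes M :: "'n::finite \<Rightarrow> 's measure" and \<gamma> :: "('n \<Rightarrow> 's set) \<Rightarrow> 'a::real_normed_field"
  assumes "finite_semivariation M \<gamma>"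
  shows "\<exists>C>0. \<forall>r E a. (\<forall>l. measurable_partition (M l) (space (M l)) (r l) (E l)) \<longrightarrow>
    (\<forall>l. \<forall>j<r l. norm (a l j) \<le> 1) \<longrightarrow>
    norm (\<Sum>k\<in>PiE UNIV (\<lambda>l. {..<r l}). (\<Prod>l\<in>UNIV. a l (k l)) * \<gamma> (\<lambda>l. E l (k l))) \<le> C"
proof -
  define s where "s = semivariation M \<gamma> (\<lambda>l. space (M l))"
  have s: "s < \<infinity>" using assms by (simp add: finite_semivariation_def s_def)
  have "norm (\<Sum>k\<in>PiE UNIV (\<lambda>l. {..<r l}). (\<Prod>l\<in>UNIV. a l (k l)) * \<gamma> (\<lambda>l. E l (k l))) \<le> enn2real s + 1"
    if "\<forall>l. measurable_partition (M l) (space (M l)) (r l) (E l)" "\<forall>l. \<forall>j<r l. norm (a l j) \<le> 1" for r E a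
  proof -
    have "ennreal (norm (\<Sum>k\<in>PiE UNIV (\<lambda>l. {..<r l}). (\<Prod>l\<in>UNIV. a l (k l)) * \<gamma> (\<lambda>l. E l (k l)))) \<le> s"
      unfolding s_def semivariation_def using that by (intro Sup_upper) blast
    then have "norm (\<Sum>k\<in>PiE UNIV (\<lambda>l. {..<r l}). (\<Prod>l\<in>UNIV. a l (k l)) * \<gamma> (\<lambda>l. E l (k l))) \<le> enn2real s"
      using enn2real_mono[of "ennreal _" s] s by fastforce
    then show ?thesis by simp
  qed
  moreover have "0 < enn2real s + 1" by (simp add: add_nonneg_pos)
  ultimately show ?thesis by blast
qed

lemma degree_bernstein_poly:
  assumes "m \<le> k" shows "degree (bernstein_poly k m) \<le> k"
proof -
  have "degree (bernstein_poly k m) \<le> degree (monom (1 :: real) m * [:1, - 1:] ^ (k - m))"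
    unfolding bernstein_poly_def by (rule degree_smult_le)
  also have "\<dots> \<le> degree (monom (1 :: real) m) + degree ([:1, - 1 :: real:] ^ (k - m))"
    by (rule degree_mult_le)
  also have "\<dots> \<le> m + (k - m)"
    using degree_power_le[of "[:1, - 1 :: real:]" "k - m"] by (simp add: degree_monom_eq)
  finally show ?thesis using assms by simp
qed

lemma poly_eq_sum_bounded_degree:
  fixes p :: "real poly"
  shows "degree p \<le> n \<Longrightarrow> poly p x = (\<Sum>i\<le>n. coeff p i * x ^ i)"
  using arg_cong[OF poly_as_sum_of_monoms'[of p n], of "\<lambda>q. poly q x"] by (simp add: poly_sum poly_monom)

text \<open>The integral is given only as a limit, so linearity is applied to the finite sums over a
  grid: the same cells serve all monomials, and a finite combination of moments is the limit of the
  same combination of grid sums.\<close>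

lemma weakly_bounded_of_solution:
  fixes \<gamma> :: "('n::finite \<Rightarrow> real set) \<Rightarrow> 'a::real_normed_field"
  assumes "weak_hausdorff_solution \<mu> \<gamma>"
  shows "weakly_bounded TYPE('a) \<mu>"
proof -
  have \<gamma>: "polymeasure (\<lambda>_. Bo_I) \<gamma>" and fin: "finite_semivariation (\<lambda>_. Bo_I) \<gamma>"
    and int: "\<And>k. has_polyintegral (\<lambda>_. Bo_I) \<gamma> (\<lambda>l t. of_real (t ^ k l)) (of_real (\<mu> k))"
    using assms by (auto simp: weak_hausdorff_solution_def)
  obtain C where C: "0 < C" and bound: "\<forall>r E a. (\<forall>l::'n. measurable_partition Bo_I (space Bo_I) (r l) (E l)) \<longrightarrow>
    (\<forall>l. \<forall>j<r l. norm (a l j) \<le> 1) \<longrightarrow>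
    norm (\<Sum>k\<in>PiE UNIV (\<lambda>l. {..<r l}). (\<Prod>l\<in>UNIV. a l (k l)) * \<gamma> (\<lambda>l. E l (k l))) \<le> C"
    using finite_semivariation_bound[OF fin] by blast
  have "norm (\<Sum>m\<in>PiE UNIV (\<lambda>l. {..k l}). (\<Prod>l\<in>UNIV. a l (m l)) * of_real (bernstein_coeff \<mu> k m)) \<le> C"
    if a: "\<forall>l. \<forall>m\<le>k l. norm (a l m) \<le> 1" for k and a :: "'n \<Rightarrow> nat \<Rightarrow> 'a"
  proof -
    define R where "R j = PiE UNIV (\<lambda>l::'n. {..<Suc (Suc j)})" for j
    \<comment> \<open>The nodes run from 0 to 1 in steps of \<open>1 / (j + 1)\<close>:
      \<open>j + 2\<close> of them, matching the index range in \<open>R j\<close>.\<close>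
    define x where "x j i = real i / real (Suc j)" for j i
    define b where "b l m e = (of_real (coeff (bernstein_poly (k l) m) e) :: 'a)" for l m e
    define S where "S j e = (\<Sum>i\<in>R j. (\<Prod>l\<in>UNIV. of_real (x j (i l) ^ e l)) * \<gamma> (\<lambda>l. cell (Suc j) (i l)))"
      for j and e :: "'n \<Rightarrow> nat"
    have S_lim: "(\<lambda>j. S j e) \<longlonglongrightarrow> of_real (\<mu> e)" for e
    proof -
      have "simple_polyintegral (\<lambda>_. Bo_I) \<gamma> (\<lambda>l t. of_real (grid (Suc j) t ^ e l)) = S j e" for j
        unfolding S_def R_def
        by (rule simple_polyintegral_partition[OF \<gamma>], rule cell_partition)
          (auto simp: cell_nonempty grid_cell x_def)
      then show ?thesis
        using int[of e] uniform_simple_approx_grid[of e, where 'a = 'a]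
        unfolding has_polyintegral_def by auto
    qed
    define P where "P = PiE UNIV (\<lambda>l::'n. {..k l})"
    have coeff_eq: "of_real (bernstein_coeff \<mu> k m) = (\<Sum>e\<in>P. (\<Prod>l\<in>UNIV. b l (m l) (e l)) * of_real (\<mu> e))"
      if "m \<in> P" for m
    proof -
      have "degree (bernstein_poly (k l) (m l)) \<le> k l" for l
        using that by (intro degree_bernstein_poly) (auto simp: P_def PiE_iff)
      from moment_functional_bound[where d = k, OF this] show ?thesis
        by (simp add: bernstein_coeff_def P_def b_def)
    qed
    \<comment> \<open>The sum to be bounded, with each moment \<open>\<mu> e\<close> replaced by its
      grid sum \<open>S j e\<close>.\<close>
    define Y where "Y j = (\<Sum>m\<in>P. (\<Prod>l\<in>UNIV. a l (m l)) * (\<Sum>e\<in>P. (\<Prod>l\<in>UNIV. b l (m l) (e l)) * S j e))" for j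
    have Y_lim: "Y \<longlonglongrightarrow> (\<Sum>m\<in>P. (\<Prod>l\<in>UNIV. a l (m l)) * of_real (bernstein_coeff \<mu> k m))"
      unfolding Y_def[abs_def] using S_lim by (auto simp: coeff_eq intro!: tendsto_intros)
    \<comment> \<open>Written through monomial coefficients, so that multiplying out the product of
      the \<open>F l\<close> reproduces \<open>Y j\<close> term by term.\<close>
    define F where "F l y = (\<Sum>m\<le>k l. a l m * (\<Sum>e\<le>k l. b l m e * of_real (y ^ e)))" for l y
    have F: "norm (F l y) \<le> 1" if y: "y \<in> {0..1}" for l y
    proof -
      have "(\<Sum>e\<le>k l. b l m e * of_real (y ^ e)) = of_real (Bernstein (k l) m y)" if "m \<le> k l" for m
        using degree_bernstein_poly[OF that]
        by (simp add: b_def poly_bernstein_poly[symmetric] poly_eq_sum_bounded_degree)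
      then have "F l y = (\<Sum>m\<le>k l. a l m * of_real (Bernstein (k l) m y))"
        by (simp add: F_def)
      also have "norm \<dots> \<le> (\<Sum>m\<le>k l. Bernstein (k l) m y)"
        using a y by (intro sum_norm_le)
          (auto simp: norm_mult Bernstein_nonneg intro!: mult_left_le_one_le)
      finally show ?thesis by simp
    qed
    have Y_eq: "Y j = (\<Sum>i\<in>R j. (\<Prod>l\<in>UNIV. F l (x j (i l))) * \<gamma> (\<lambda>l. cell (Suc j) (i l)))" for j
    proof -
      have "(\<Prod>l\<in>UNIV. F l (x j (i l))) = (\<Sum>m\<in>P. (\<Prod>l\<in>UNIV. a l (m l)) *
          (\<Sum>e\<in>P. (\<Prod>l\<in>UNIV. b l (m l) (e l)) * (\<Prod>l\<in>UNIV. of_real (x j (i l) ^ e l))))" for i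
        unfolding F_def P_def by (simp add: prod_sum_PiE prod.distrib)
      then have "(\<Sum>i\<in>R j. (\<Prod>l\<in>UNIV. F l (x j (i l))) * \<gamma> (\<lambda>l. cell (Suc j) (i l))) =
          (\<Sum>i\<in>R j. \<Sum>m\<in>P. \<Sum>e\<in>P. (\<Prod>l\<in>UNIV. a l (m l)) * ((\<Prod>l\<in>UNIV. b l (m l) (e l)) *
            ((\<Prod>l\<in>UNIV. of_real (x j (i l) ^ e l)) * \<gamma> (\<lambda>l. cell (Suc j) (i l)))))"
        by (simp add: sum_distrib_left sum_distrib_right mult.assoc)
      also have "\<dots> = (\<Sum>m\<in>P. \<Sum>e\<in>P. \<Sum>i\<in>R j. (\<Prod>l\<in>UNIV. a l (m l)) * ((\<Prod>l\<in>UNIV. b l (m l) (e l)) *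
            ((\<Prod>l\<in>UNIV. of_real (x j (i l) ^ e l)) * \<gamma> (\<lambda>l. cell (Suc j) (i l)))))"
        by (rule trans[OF sum.swap], rule sum.cong[OF refl], rule sum.swap)
      also have "\<dots> = Y j" by (simp add: Y_def S_def sum_distrib_left)
      finally show ?thesis ..
    qed
    have "norm (Y j) \<le> C" for j
      unfolding Y_eq R_def
    proof (rule bound[rule_format])
      fix l i assume "i < Suc (Suc j)"
      then show "norm (F l (x j i)) \<le> 1" by (intro F) (auto simp: x_def divide_le_eq_1)
    qed (rule cell_partition, simp)
    then show ?thesis
      unfolding P_def[symmetric] by (intro Lim_norm_ubound[OF _ Y_lim]) auto
  qed
  then show ?thesis unfolding weakly_bounded_def using C by blast
qed

subsection \<open>Weak boundedness implies solvability\<close>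

text \<open>Entries are replaced one at a time. Replacing \<open>h i\<close> by \<open>g j i\<close>
  changes the value by \<open>T\<close> at a tuple whose entry at \<open>i\<close> is uniformly
  small, while the other entries are bounded by \<open>c l + 1\<close>. Both hold only for large
  \<open>j\<close>, since the \<open>g j l\<close> may be unbounded before.\<close>

lemma moment_extension_tendsto:
  fixes g :: "nat \<Rightarrow> 'n::finite \<Rightarrow> real \<Rightarrow> real"
  assumes T: "moment_extension UNIV K \<mu> T" and K: "0 \<le> K"
    and g: "\<And>j l. g j l \<in> borel_measurable borel" and h: "\<And>l. \<exists>c. bounded_borel c (h l)"
    and lim: "\<And>l. uniform_limit {0..1} (\<lambda>j. g j l) (h l) sequentially"
  shows "(\<lambda>j. T (g j)) \<longlonglongrightarrow> T h"
proof -
  obtain c where c: "\<And>l. bounded_borel (c l) (h l)" using h by metis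
  have h_meas: "h l \<in> borel_measurable borel" and c_pos: "0 < c l" for l
    using c[of l] by (auto simp: bounded_borel_def)
  have "(\<lambda>j. T (\<lambda>l. if l \<in> A then g j l else h l)) \<longlonglongrightarrow> T h" if "finite A" for A
    using that
  proof (induction A rule: finite_induct)
    case empty
    show ?case by simp
  next
    case (insert i A)
    define y where "y j = (\<lambda>l. if l \<in> A then g j l else h l)" for j
    define d where "d j = (\<lambda>t. - 1 * h i t + g j i t)" for j
    define C where "C = K * (\<Prod>l\<in>UNIV - {i}. c l + 1)"
    have C: "0 \<le> C" unfolding C_def using K c_pos
      by (intro mult_nonneg_nonneg prod_nonneg) (simp_all add: add_nonneg_nonneg less_imp_le)
    have close: "\<forall>\<^sub>F j in sequentially. \<forall>l. \<forall>t\<in>{0..1}. \<bar>g j l t - h l t\<bar> < e" if "0 < e" for e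
      using lim uniform_limitD[OF lim that] by (subst eventually_all_finite) (auto simp: dist_real_def)
    have bounds: "bounded_borel (c l + 1) (y j l)"
      if "\<forall>l. \<forall>t\<in>{0..1}. \<bar>g j l t - h l t\<bar> < 1" for j l
      unfolding bounded_borel_def
    proof (intro conjI ballI)
      show "0 < c l + 1" using c_pos[of l] by simp
      show "y j l \<in> borel_measurable borel" using g h_meas by (simp add: y_def)
      fix t :: real assume t: "t \<in> {0..1}"
      have "\<bar>g j l t - h l t\<bar> < 1" "\<bar>h l t\<bar> \<le> c l" using that t c[of l] by (auto simp: bounded_borel_def)
      then show "\<bar>y j l t\<bar> \<le> c l + 1" by (auto simp: y_def)
    qed
    have diff: "\<bar>T ((y j)(i := d j))\<bar> \<le> C * e"
      if e: "0 < e" and j1: "\<forall>l. \<forall>t\<in>{0..1}. \<bar>g j l t - h l t\<bar> < 1"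
        and je: "\<forall>l. \<forall>t\<in>{0..1}. \<bar>g j l t - h l t\<bar> < e" for j e
    proof -
      have "bounded_borel e (d j)"
        using e je g h_meas by (auto simp: bounded_borel_def d_def intro!: less_imp_le)
      then have "\<bar>T ((y j)(i := d j))\<bar> \<le> K * (\<Prod>l\<in>UNIV. ((\<lambda>l. c l + 1)(i := e)) l)"
        by (intro moment_extension_bound[OF T]) (simp add: test_bound_def bounds[OF j1])
      then show ?thesis by (simp only: prod_fun_upd C_def) (simp add: algebra_simps)
    qed
    have "(\<lambda>j. T ((y j)(i := d j))) \<longlonglongrightarrow> 0"
    proof (rule tendstoI)
      fix e :: real assume e: "0 < e"
      define e' where "e' = e / (C + 1)"
      have e': "0 < e'" "C * e' < e" using e C by (simp_all add: e'_def field_simps)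
      show "\<forall>\<^sub>F j in sequentially. dist (T ((y j)(i := d j))) 0 < e"
        using close[OF zero_less_one] close[OF e'(1)]
      proof eventually_elim
        case (elim j)
        show ?case using diff[OF e'(1) elim] e'(2) by simp
      qed
    qed
    then have "(\<lambda>j. T ((y j)(i := d j)) + T (y j)) \<longlonglongrightarrow> 0 + T h"
      using insert.IH by (intro tendsto_add) (simp_all add: y_def)
    moreover have "\<forall>\<^sub>F j in sequentially.
        T ((y j)(i := d j)) + T (y j) = T (\<lambda>l. if l \<in> insert i A then g j l else h l)"
      using close[OF zero_less_one]
    proof eventually_elim
      case (elim j)
      have tf: "test_fun (l \<in> UNIV) (y j l)" for l
        using bounds[OF elim] by (auto simp: test_fun_def)
      have gi: "test_fun (i \<in> UNIV) (g j i)"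
      proof -
        have "bounded_borel (c i + 1) (g j i)"
          unfolding bounded_borel_def
        proof (intro conjI ballI)
          fix t :: real assume t: "t \<in> {0..1}"
          have "\<bar>g j i t - h i t\<bar> < 1" "\<bar>h i t\<bar> \<le> c i" using elim t c[of i] by (auto simp: bounded_borel_def)
          then show "\<bar>g j i t\<bar> \<le> c i + 1" by auto
        qed (use g c_pos[of i] in auto)
        then show ?thesis by (auto simp: test_fun_def)
      qed
      have hi: "test_fun (i \<in> UNIV) (h i)" using c[of i] by (auto simp: test_fun_def)
      have "T ((y j)(i := d j)) = - 1 * T ((y j)(i := h i)) + T ((y j)(i := g j i))"
        unfolding d_def by (rule moment_extension_lin[OF T tf hi gi])
      moreover have "(y j)(i := h i) = y j" using insert.hyps by (auto simp: y_def)
      moreover have "(y j)(i := g j i) = (\<lambda>l. if l \<in> insert i A then g j l else h l)" by (auto simp: y_def)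
      ultimately show ?case by simp
    qed
    ultimately show ?case by (simp add: tendsto_cong)
  qed
  from this[of UNIV] show ?thesis by simp
qed

text \<open>\<open>T\<close> is multilinear over the reals. Expanding the values of each
  \<open>f l\<close> in the orthonormal basis and multiplying out extends it to scalar-valued
  functions; over the complex numbers, with basis 1 and i, this is complexification.\<close>

definition scalar_extension ::
  "(('n::finite \<Rightarrow> real \<Rightarrow> real) \<Rightarrow> real) \<Rightarrow> ('n \<Rightarrow> real \<Rightarrow> 'a::{real_normed_field, euclidean_space}) \<Rightarrow> 'a" where
  "scalar_extension T f =
     (\<Sum>\<beta>\<in>PiE UNIV (\<lambda>_. Basis). (\<Prod>l\<in>UNIV. \<beta> l) * of_real (T (\<lambda>l t. f l t \<bullet> \<beta> l)))"

lemma prod_euclidean_expand: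
  fixes a :: "'n::finite \<Rightarrow> 'a::{real_normed_field, euclidean_space}"
  shows "(\<Sum>\<beta>\<in>PiE UNIV (\<lambda>_. Basis). (\<Prod>l\<in>UNIV. \<beta> l) * of_real (\<Prod>l\<in>UNIV. a l \<bullet> \<beta> l)) = (\<Prod>l\<in>UNIV. a l)"
proof -
  have "(\<Prod>l\<in>UNIV. a l) = (\<Prod>l\<in>UNIV. \<Sum>b\<in>Basis. b * of_real (a l \<bullet> b))"
    by (subst euclidean_representation[symmetric]) (simp add: scaleR_conv_of_real mult.commute)
  also have "\<dots> = (\<Sum>\<beta>\<in>PiE UNIV (\<lambda>_. Basis). \<Prod>l\<in>UNIV. \<beta> l * of_real (a l \<bullet> \<beta> l))"
    by (rule prod_sum_PiE) auto
  finally show ?thesis by (simp add: prod.distrib)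
qed

lemma scalar_extension_expand:
  fixes J :: "'n::finite \<Rightarrow> 'j set" and a :: "'n \<Rightarrow> 'j \<Rightarrow> 'a::{real_normed_field, euclidean_space}"
  assumes T: "moment_extension UNIV K \<mu> T" and J: "\<And>l. finite (J l)"
    and g: "\<And>l j. j \<in> J l \<Longrightarrow> \<exists>c. bounded_borel c (g l j)"
  shows "scalar_extension T (\<lambda>l t. \<Sum>j\<in>J l. g l j t *\<^sub>R a l j) =
    (\<Sum>k\<in>PiE UNIV J. (\<Prod>l\<in>UNIV. a l (k l)) * of_real (T (\<lambda>l. g l (k l))))"
proof -
  have "T (\<lambda>l t. (\<Sum>j\<in>J l. g l j t *\<^sub>R a l j) \<bullet> \<beta> l) =
      (\<Sum>k\<in>PiE UNIV J. (\<Prod>l\<in>UNIV. a l (k l) \<bullet> \<beta> l) * T (\<lambda>l. g l (k l)))" for \<beta>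
    using moment_extension_expand[OF T J, where g = g and a = "\<lambda>l j. a l j \<bullet> \<beta> l"] g
    by (simp add: inner_sum_left test_fun_def mult.commute)
  then have "scalar_extension T (\<lambda>l t. \<Sum>j\<in>J l. g l j t *\<^sub>R a l j) =
      (\<Sum>\<beta>\<in>PiE UNIV (\<lambda>_. Basis). \<Sum>k\<in>PiE UNIV J.
        ((\<Prod>l\<in>UNIV. \<beta> l) * of_real (\<Prod>l\<in>UNIV. a l (k l) \<bullet> \<beta> l)) * of_real (T (\<lambda>l. g l (k l))))"
    by (simp add: scalar_extension_def sum_distrib_left mult.assoc)
  also have "\<dots> = (\<Sum>k\<in>PiE UNIV J. (\<Sum>\<beta>\<in>PiE UNIV (\<lambda>_. Basis).
        (\<Prod>l\<in>UNIV. \<beta> l) * of_real (\<Prod>l\<in>UNIV. a l (k l) \<bullet> \<beta> l)) * of_real (T (\<lambda>l. g l (k l))))"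
    by (subst sum.swap) (simp only: sum_distrib_right)
  finally show ?thesis by (simp only: prod_euclidean_expand)
qed

text \<open>\<open>\<gamma>\<close> has real values over either field. Scalars enter through the
  coefficients in the semivariation and through the approximating simple functions; the sums formed
  in both cases are values of \<open>scalar_extension T\<close> at step functions.\<close>

lemma solution_of_weakly_bounded:
  fixes \<mu> :: "('n::finite \<Rightarrow> nat) \<Rightarrow> real"
  assumes "weakly_bounded TYPE(real) \<mu>"
  shows "\<exists>\<gamma> :: ('n \<Rightarrow> real set) \<Rightarrow> 'a::{real_normed_field, euclidean_space}. weak_hausdorff_solution \<mu> \<gamma>"
proof -
  obtain K T where K: "0 < K" and T: "moment_extension UNIV K \<mu> T"
    using moment_extension_exists[OF assms] by blast
  define \<gamma> where "\<gamma> A = (of_real (T (\<lambda>l. indicator (A l))) :: 'a)" for A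
  have ind: "\<exists>c. bounded_borel c (indicator A)" if "A \<in> sets Bo_I" for A
    using that bounded_borel_indicator by (auto simp: sets_Bo_I)
  have sum_ind: "scalar_extension T (\<lambda>l t. \<Sum>j\<in>J l. indicator (E l j) t *\<^sub>R a l j) =
      (\<Sum>k\<in>PiE UNIV J. (\<Prod>l\<in>UNIV. a l (k l)) * \<gamma> (\<lambda>l. E l (k l)))"
    if "\<And>l. finite (J l)" "\<And>l j. j \<in> J l \<Longrightarrow> E l j \<in> sets Bo_I"
    for J :: "'n \<Rightarrow> 'j set" and a :: "'n \<Rightarrow> 'j \<Rightarrow> 'a" and E
    unfolding \<gamma>_def using that ind by (intro scalar_extension_expand[OF T]) auto
  have "polymeasure (\<lambda>_. Bo_I) \<gamma>"
    unfolding polymeasure_def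
  proof (intro allI impI)
    fix A :: "'n \<Rightarrow> real set" and l B
    assume A: "\<forall>i. A i \<in> sets Bo_I" and B: "range B \<subseteq> sets Bo_I" and disj: "disjoint_family (B :: nat \<Rightarrow> _)"
    have upd: "(\<lambda>m. indicator ((A(l := X)) m)) = (\<lambda>m. indicator (A m) :: real \<Rightarrow> real)(l := indicator X)" for X
      by auto
    have Bj: "B j \<in> sets borel" for j using range_subsetD[OF B] by (simp add: sets_Bo_I)
    have "(\<lambda>j. T ((\<lambda>m. indicator (A m))(l := indicator (B j)))) sums
        T ((\<lambda>m. indicator (A m))(l := indicator (\<Union>j. B j)))"
    proof (rule moment_extension_sums[OF T])
      show "test_fun (m \<in> UNIV) (indicator (A m))" for m using A ind by (simp add: test_fun_def)
      fix t :: real and N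
      show "(\<lambda>j. indicator (B j) t :: real) sums indicator (\<Union>j. B j) t"
        using disj by (intro indicator_sums) (auto simp: disjoint_family_on_def)
      show "(\<Sum>j<N. \<bar>indicator (B j) t\<bar>) \<le> (1 :: real)"
        using disj by (rule sum_indicator_disjoint_le)
    qed (use Bj in auto)
    then show "(\<lambda>j. \<gamma> (A(l := B j))) sums \<gamma> (A(l := (\<Union>j. B j)))"
      unfolding \<gamma>_def upd by (rule sums_of_real)
  qed
  moreover have "finite_semivariation (\<lambda>_. Bo_I) \<gamma>"
  proof -
    \<comment> \<open>One summand \<open>K\<close> for each tuple of basis vectors: every component
      \<open>f l t \<bullet> \<beta> l\<close> has modulus at most 1 on the unit interval.\<close>
    have bound: "norm (\<Sum>k\<in>PiE UNIV (\<lambda>l. {..<r l}). (\<Prod>l\<in>UNIV. a l (k l)) * \<gamma> (\<lambda>l. E l (k l)))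
        \<le> (\<Sum>\<beta>\<in>PiE (UNIV :: 'n set) (\<lambda>_. Basis :: 'a set). K)"
      if part: "\<forall>l. measurable_partition Bo_I (space Bo_I) (r l) (E l)"
        and a: "\<forall>l. \<forall>j<r l. norm (a l j :: 'a) \<le> 1" for r E a
    proof -
      define f where "f l t = (\<Sum>j<r l. indicator (E l j) t *\<^sub>R a l j)" for l t
      have E: "\<And>l j. j < r l \<Longrightarrow> E l j \<in> sets Bo_I" using part by (auto simp: measurable_partition_def)
      have f: "norm (f l t) \<le> 1" if t: "t \<in> {0..1}" for l t
      proof -
        obtain j where j: "j < r l" "t \<in> E l j"
          using part[rule_format, of l] t unfolding measurable_partition_def space_Bo_I by blast
        have "f l t = (\<Sum>i<r l. if i = j then a l j else 0)"
          unfolding f_def using part[rule_format, of l] j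
          by (intro sum.cong) (auto simp: measurable_partition_def disjoint_family_on_def indicator_def)
        then show ?thesis using a j by simp
      qed
      have "norm (scalar_extension T f) \<le> (\<Sum>\<beta>\<in>PiE (UNIV :: 'n set) (\<lambda>_. Basis :: 'a set). K)"
        unfolding scalar_extension_def
      proof (rule sum_norm_le)
        fix \<beta> :: "'n \<Rightarrow> 'a" assume \<beta>: "\<beta> \<in> PiE UNIV (\<lambda>_. Basis)"
        then have nb: "norm (\<beta> l) = 1" for l by (auto simp: PiE_iff)
        have "bounded_borel 1 (\<lambda>t. f l t \<bullet> \<beta> l)" for l
          unfolding bounded_borel_def
        proof (intro conjI ballI)
          have "(\<lambda>t. f l t \<bullet> \<beta> l) = (\<lambda>t. \<Sum>j<r l. indicator (E l j) t * (a l j \<bullet> \<beta> l))"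
            by (simp add: f_def inner_sum_left)
          moreover have "\<dots> \<in> borel_measurable borel"
            using E by (intro borel_measurable_sum borel_measurable_times borel_measurable_const
              borel_measurable_indicator) (auto simp: sets_Bo_I)
          ultimately show "(\<lambda>t. f l t \<bullet> \<beta> l) \<in> borel_measurable borel" by simp
          fix t :: real assume "t \<in> {0..1}"
          then show "\<bar>f l t \<bullet> \<beta> l\<bar> \<le> 1"
            using Cauchy_Schwarz_ineq2[of "f l t" "\<beta> l"] f[of t l] nb[of l] by simp
        qed simp
        then have "\<bar>T (\<lambda>l t. f l t \<bullet> \<beta> l)\<bar> \<le> K * (\<Prod>l\<in>(UNIV :: 'n set). 1)"
          by (intro moment_extension_bound[OF T]) (simp add: test_bound_def)
        then show "norm ((\<Prod>l\<in>UNIV. \<beta> l) * of_real (T (\<lambda>l t. f l t \<bullet> \<beta> l))) \<le> K"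
          by (simp add: norm_mult nb flip: prod_norm)
      qed
      then show ?thesis
        unfolding f_def using sum_ind[of "\<lambda>l. {..<r l}" E a] E by simp
    qed
    have "semivariation (\<lambda>_. Bo_I) \<gamma> (\<lambda>l. space Bo_I) \<le>
        ennreal (\<Sum>\<beta>\<in>PiE (UNIV :: 'n set) (\<lambda>_. Basis :: 'a set). K)"
      unfolding semivariation_def using bound by (intro Sup_least) (auto intro!: ennreal_leI)
    then show ?thesis unfolding finite_semivariation_def by (simp add: le_less_trans)
  qed
  moreover have "has_polyintegral (\<lambda>_. Bo_I) \<gamma> (\<lambda>l t. of_real (t ^ k l)) (of_real (\<mu> k))" for k
    unfolding has_polyintegral_def
  proof (intro conjI allI impI)
    show "\<exists>s. uniform_simple_approx (\<lambda>_. Bo_I) s (\<lambda>l t. of_real (t ^ k l) :: 'a)"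
      using uniform_simple_approx_grid by blast
  next
    fix s :: "nat \<Rightarrow> 'n \<Rightarrow> real \<Rightarrow> 'a"
    assume "uniform_simple_approx (\<lambda>_. Bo_I) s (\<lambda>l t. of_real (t ^ k l))"
    then have simple: "\<And>j l. simple_function Bo_I (s j l)"
      and lim: "\<And>l. uniform_limit {0..1} (\<lambda>j. s j l) (\<lambda>t. of_real (t ^ k l)) sequentially"
      by (auto simp: uniform_simple_approx_def space_Bo_I)
    define Y where "Y j l = s j l ` {0..1}" for j l
    define E where "E j l y = s j l -` {y} \<inter> {0..1}" for j l y
    \<comment> \<open>Agrees with \<open>s\<close> on the unit interval and is 0 outside, so its
      components are Borel measurable on the whole line, where the arguments of \<open>T\<close> are
      defined.\<close>
    define s' where "s' j l t = (\<Sum>y\<in>Y j l. indicator (E j l y) t *\<^sub>R y)" for j l t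
    have Y: "finite (Y j l)" for j l
      using simple[of j l] by (simp add: simple_function_def Y_def space_Bo_I)
    have E: "E j l y \<in> sets Bo_I" if "y \<in> Y j l" for j l y
      using simple[of j l] that by (auto simp: simple_function_def Y_def E_def space_Bo_I)
    have s': "s' j l t = s j l t" if "t \<in> {0..1}" for j l t
    proof -
      have "s' j l t = (\<Sum>y\<in>Y j l. if y = s j l t then y else 0)"
        unfolding s'_def using that by (intro sum.cong) (auto simp: E_def indicator_def)
      then show ?thesis using Y[of j l] that by (simp add: Y_def)
    qed
    have integral: "simple_polyintegral (\<lambda>_. Bo_I) \<gamma> (s j) = scalar_extension T (s' j)" for j
    proof -
      have "simple_polyintegral (\<lambda>_. Bo_I) \<gamma> (s j) =
          (\<Sum>y\<in>PiE UNIV (Y j). (\<Prod>l\<in>UNIV. y l) * \<gamma> (\<lambda>l. E j l (y l)))"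
        by (simp add: simple_polyintegral_def space_Bo_I Y_def[abs_def] E_def)
      also have "\<dots> = scalar_extension T (s' j)"
        unfolding s'_def[abs_def] by (rule sum_ind[OF Y E, symmetric])
      finally show ?thesis .
    qed
    have T_lim: "(\<lambda>j. T (\<lambda>l t. s' j l t \<bullet> \<beta> l)) \<longlonglongrightarrow> (\<Prod>l\<in>UNIV. 1 \<bullet> \<beta> l) * \<mu> k"
      if \<beta>: "\<beta> \<in> PiE UNIV (\<lambda>_. Basis)" for \<beta> :: "'n \<Rightarrow> 'a"
    proof -
      have pow: "\<exists>c. bounded_borel c (\<lambda>t. t ^ m)" for m
        by (intro bounded_borel_continuous continuous_intros)
      \<comment> \<open>The sum over a singleton presents \<open>1 \<bullet> \<beta> l\<close> as a
        coefficient, so that \<open>moment_extension_expand\<close> can move it out of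
        \<open>T\<close>.\<close>
      have "(\<lambda>j. T (\<lambda>l t. s' j l t \<bullet> \<beta> l)) \<longlonglongrightarrow> T (\<lambda>l t. \<Sum>i\<in>{0::nat}. (1 \<bullet> \<beta> l) * t ^ k l)"
      proof (rule moment_extension_tendsto[OF T])
        fix j l
        have "(\<lambda>t. s' j l t \<bullet> \<beta> l) = (\<lambda>t. \<Sum>y\<in>Y j l. indicator (E j l y) t * (y \<bullet> \<beta> l))"
          by (simp add: s'_def inner_sum_left)
        moreover have "\<dots> \<in> borel_measurable borel"
          using E by (intro borel_measurable_sum borel_measurable_times borel_measurable_const
            borel_measurable_indicator) (auto simp: sets_Bo_I)
        ultimately show "(\<lambda>t. s' j l t \<bullet> \<beta> l) \<in> borel_measurable borel" by simp
      next
        fix l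
        show "\<exists>c. bounded_borel c (\<lambda>t. \<Sum>i\<in>{0::nat}. (1 \<bullet> \<beta> l) * t ^ k l)"
          using pow by (intro bounded_borel_sum) auto
        show "uniform_limit {0..1} (\<lambda>j t. s' j l t \<bullet> \<beta> l) (\<lambda>t. \<Sum>i\<in>{0::nat}. (1 \<bullet> \<beta> l) * t ^ k l) sequentially"
        proof (rule uniform_limitI)
          fix e :: real assume "0 < e"
          from uniform_limitD[OF lim[of l] this]
          show "\<forall>\<^sub>F j in sequentially. \<forall>t\<in>{0..1}. dist (s' j l t \<bullet> \<beta> l) (\<Sum>i\<in>{0::nat}. (1 \<bullet> \<beta> l) * t ^ k l) < e"
          proof eventually_elim
            case (elim j)
            show ?case
            proof
              fix t :: real assume t: "t \<in> {0..1}"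
              have "(\<Sum>i\<in>{0::nat}. (1 \<bullet> \<beta> l) * t ^ k l) = of_real (t ^ k l) \<bullet> \<beta> l"
                by (simp only: of_real_def inner_scaleR_left) simp
              then have "dist (s' j l t \<bullet> \<beta> l) (\<Sum>i\<in>{0::nat}. (1 \<bullet> \<beta> l) * t ^ k l) =
                  \<bar>(s j l t - of_real (t ^ k l)) \<bullet> \<beta> l\<bar>"
                by (simp add: s'[OF t] dist_real_def inner_diff_left)
              also have "\<dots> \<le> norm (s j l t - of_real (t ^ k l)) * norm (\<beta> l)"
                by (rule Cauchy_Schwarz_ineq2)
              also have "norm (\<beta> l) = 1" using \<beta> by (auto simp: PiE_iff)
              also have "norm (s j l t - of_real (t ^ k l)) * 1 < e"
                using elim t by (simp add: dist_norm)
              finally show "dist (s' j l t \<bullet> \<beta> l) (\<Sum>i\<in>{0::nat}. (1 \<bullet> \<beta> l) * t ^ k l) < e" .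
            qed
          qed
        qed
      qed (use K in simp)
      also have "T (\<lambda>l t. \<Sum>i\<in>{0::nat}. (1 \<bullet> \<beta> l) * t ^ k l) =
          (\<Sum>i\<in>PiE (UNIV :: 'n set) (\<lambda>_. {0::nat}). (\<Prod>l\<in>UNIV. 1 \<bullet> \<beta> l) * T (\<lambda>l t. t ^ k l))"
        using pow by (intro moment_extension_expand[OF T, where a = "\<lambda>l _. 1 \<bullet> \<beta> l" and g = "\<lambda>l _ t. t ^ k l"])
            (auto simp: test_fun_def)
      also have "PiE (UNIV :: 'n set) (\<lambda>_. {0::nat}) = {\<lambda>_. 0}"
        using PiE_singleton[of "\<lambda>_. 0" "UNIV :: 'n set"] by (simp add: extensional_def)
      finally show ?thesis by (simp add: moment_extension_moments[OF T])
    qed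
    have "(\<lambda>j. scalar_extension T (s' j)) \<longlonglongrightarrow>
        (\<Sum>\<beta>\<in>PiE (UNIV :: 'n set) (\<lambda>_. Basis). (\<Prod>l\<in>UNIV. \<beta> l) * of_real ((\<Prod>l\<in>UNIV. 1 \<bullet> \<beta> l) * \<mu> k))"
      unfolding scalar_extension_def
      by (intro tendsto_sum tendsto_mult tendsto_const tendsto_of_real T_lim)
    also have "(\<Sum>\<beta>\<in>PiE (UNIV :: 'n set) (\<lambda>_. Basis). (\<Prod>l\<in>UNIV. \<beta> l) * of_real ((\<Prod>l\<in>UNIV. 1 \<bullet> \<beta> l) * \<mu> k)) =
        (\<Sum>\<beta>\<in>PiE (UNIV :: 'n set) (\<lambda>_. Basis). (\<Prod>l\<in>UNIV. \<beta> l) * of_real (\<Prod>l\<in>UNIV. 1 \<bullet> \<beta> l)) * (of_real (\<mu> k) :: 'a)"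
      by (simp only: sum_distrib_right of_real_mult mult.assoc)
    \<comment> \<open>The product expansion with all factors equal to 1.\<close>
    also have "\<dots> = of_real (\<mu> k)"
      by (simp only: prod_euclidean_expand) simp
    finally show "(\<lambda>j. simple_polyintegral (\<lambda>_. Bo_I) \<gamma> (s j)) \<longlonglongrightarrow> of_real (\<mu> k)"
      unfolding integral .
  qed
  ultimately show ?thesis unfolding weak_hausdorff_solution_def by blast
qed

text \<open>Real coefficients embed isometrically by \<open>of_real\<close>, so a bound over any
  scalar field contains the real one, and the real bound is what the construction of a solution over
  either field starts from.\<close>

lemma weakly_bounded_imp_real:
  assumes "weakly_bounded TYPE('a::real_normed_field) \<mu>"
  shows "weakly_bounded TYPE(real) \<mu>"
proof -
  obtain C where C: "0 < C" and bound: "\<And>k a. (\<forall>l. \<forall>m\<le>k l. norm (a l m :: 'a) \<le> 1) \<Longrightarrow>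
      norm (\<Sum>m\<in>PiE UNIV (\<lambda>l. {..k l}). (\<Prod>l\<in>UNIV. a l (m l)) * of_real (bernstein_coeff \<mu> k m)) \<le> C"
    using assms unfolding weakly_bounded_def by blast
  have "norm (\<Sum>m\<in>PiE UNIV (\<lambda>l. {..k l}). (\<Prod>l\<in>UNIV. a l (m l)) * of_real (bernstein_coeff \<mu> k m)) \<le> C"
    if "\<forall>l. \<forall>m\<le>k l. norm (a l m) \<le> 1" for k and a :: "_ \<Rightarrow> _ \<Rightarrow> real"
  proof -
    have "norm (of_real (\<Sum>m\<in>PiE UNIV (\<lambda>l. {..k l}). (\<Prod>l\<in>UNIV. a l (m l)) * bernstein_coeff \<mu> k m) :: 'a) \<le> C"
      using bound[of k "\<lambda>l m. of_real (a l m)"] that by simp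
    then show ?thesis by (simp only: norm_of_real of_real_eq_id id_apply real_norm_def)
  qed
  then show ?thesis unfolding weakly_bounded_def using C by blast
qed

theorem theorem2p2:
  fixes \<mu> :: "('n::finite \<Rightarrow> nat) \<Rightarrow> real"
  shows "((\<exists>\<gamma> :: ('n \<Rightarrow> real set) \<Rightarrow> real. weak_hausdorff_solution \<mu> \<gamma>)
            \<longleftrightarrow> weakly_bounded TYPE(real) \<mu>) \<and>
         ((\<exists>\<gamma> :: ('n \<Rightarrow> real set) \<Rightarrow> complex. weak_hausdorff_solution \<mu> \<gamma>)
            \<longleftrightarrow> weakly_bounded TYPE(complex) \<mu>)"
  by (intro conjI iffI; (elim exE)?; (rule weakly_bounded_of_solution solution_of_weakly_bounded)?)
    (assumption | rule weakly_bounded_imp_real)+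

end
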